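(* Let $\boldsymbol{\Phi}$ be an autonomous conformal iterated function system (ACIFS) in $\mathbb{R}^d$ satisfying the open set condition. Let $\mu$ be a Gibbs measure on $\Sigma^\infty$ whose image measure $\mu^\omega$ satisfies the bounded overlap condition. Then for all $q>0$ with $q\ne1$, the generalized $q$-dimension $D_q(\mu^\omega)$ exists and $$D_q(\mu^\omega)=d_q.$$
   Context: Words. $I$ is a finite index set with $\#I\ge2$. $\Sigma^k=I^k$ for $k\ge1$, $\Sigma^0=\{\emptyset\}$ (empty word), $\Sigma^*=\bigcup_{k\ge0}\Sigma^k$, $\Sigma^\infty=I^{\mathbb{N}}=\{u_1u_2\ldots:u_k\in I\}$. $\mathbf u|_n$ is the prefix of length $n$ of $\mathbf u$. $[\mathbf u]=\{\mathbf v\in\Sigma^\infty:\mathbf u\text{ is a prefix of }\mathbf v\}$. $\Sigma^\infty$ has the metric $d(\mathbf u,\mathbf v)=2^{-|\mathbf u\wedge\mathbf v|}$, with $|\mathbf u\wedge\mathbf v|$ the length of the longest common prefix. $\sigma(u_1u_2\ldots)=u_2u_3\ldots$ is the shift. ACIFS. This is a non-autonomous conformal IFS $\boldsymbol\Phi=\{\Phi_k\}_{k\ge1}$ with $\Phi_k=\Phi_1=\{\varphi_i\}_{i\in I}$ for all $k$. Explicitly: $J\subset\mathbb{R}^d$ is compact with non-empty interior and $\overline{\mathrm{int}(J)}=J$; $\varphi_i:J\to J$; $\varphi_{\mathbf u}=\varphi_{u_1}\circ\cdots\circ\varphi_{u_k}$ for $\mathbf u=u_1\ldots u_k$ ($\varphi_\emptyset$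 the identity); and there are closed sets $J_{\mathbf u}\subset J$ ($\mathbf u\in\Sigma^*$, $J_\emptyset=J$) such that: (i) there is $0<c<1$ with $|\varphi_i(x)-\varphi_i(y)|\le c|x-y|$ for all $i\in I$, $x,y\in J$; (ii) $J_{\mathbf ui}\subset J_{\mathbf u}$ for all $\mathbf u\in\Sigma^*$, $i\in I$; (iii) for each $\mathbf u\in\Sigma^*$ there is $\omega_{\mathbf u}\in\mathbb{R}^d$ with $J_{\mathbf u}=\Psi_{\mathbf u}(J)=\varphi_{\mathbf u}(J)+\omega_{\mathbf u}$, where $\Psi_{\mathbf u}=\varphi_{\mathbf u}+\omega_{\mathbf u}$ (the translations $\omega_{\mathbf u}$ may depend arbitrarily on $\mathbf u$); (iv) there is an open connected set $V\supset J$ such that each $\varphi_i$ extends to a $C^1$ conformal diffeomorphism of $V$ into $V$; (v) there is $C\ge1$ with $\|D\varphi_{\mathbf u}(x)\|\le C\|D\varphi_{\mathbf u}(y)\|$ for all $\mathbf u\in\Sigma^*$, $x,y\in V$. $\|D\varphi_{\mathbf u}\|=\sup_{x\in J}\|D\varphi_{\mathbf u}(x)\|$. The attractor is $E=\bigcap_{k\ge1}\bigcup_{\mathbf u\in\Sigma^k}J_{\mathbf u}$. Open set condition: $\mathrm{int}(J_{\mathbf ui})\cap\mathrm{int}(J_{\mathbf uj})=\emptyset$ for all $\mathbf u\in\Sigma^*$ and $i\ne j\in I$. Image measure. $\pi(\mathbf u)=\bigcap_{n\ge1}J_{\mathbf u|_n}$ (a single point), $\mu^\omega(A)=\mu\{\mathbf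 u:\pi(\mathbf u)\in A\}$. Bounded overlap condition: there is $C\ge1$ with $C^{-1}\mu^\omega(J_{\mathbf u})\le\mu([\mathbf u])\le C\mu^\omega(J_{\mathbf u})$ for all $\mathbf u\in\Sigma^*$. Gibbs measure. A Borel probability measure $\mu$ on $\Sigma^\infty$ is a Gibbs measure if there exist a continuous $f:\Sigma^\infty\to\mathbb{R}$, a number $P(f)$ and $a>0$ such that, with $S_kf(\mathbf u)=\sum_{j=0}^{k-1}f(\sigma^j\mathbf u)$, $a\le\frac{\mu([\mathbf u|_k])}{\exp(-kP(f)+S_kf(\mathbf u))}\le\frac1a$ for all $\mathbf u\in\Sigma^\infty$ and all $k$. Generalized $q$-dimension ($q\ne1$). For a positive finite Borel measure $\nu$ on $\mathbb{R}^d$ and $\mathcal M_\delta$ the family of $\delta$-mesh cubes $\prod_{j=1}^d[m_j\delta,(m_j+1)\delta)$, $m_j\in\mathbb{Z}$, $\underline D_q(\nu)$ and $\overline D_q(\nu)$ are the $\liminf$ and $\limsup$ as $\delta\to0$ of $\frac{\log\sum_{Q\in\mathcal M_\delta}\nu(Q)^q}{(q-1)\log\delta}$; $D_q(\nu)$ is the common value when they agree. Pressure. For $t\in\mathbb{R}$, $q>0$, $q\ne1$, $P^\mu(t,q)=\lim_{k\to\infty}\frac{\mathrm{sgn}(1-q)}{k}\log\sum_{\mathbf u\in\Sigma^k}\|D\varphi_{\mathbf u}\|^{t(1-q)}\mu([\mathbf u])^q$; for an ACIFS and a Gibbs measure $\mu$ this limit exists, and $d_q=\inf\{t:P^\mu(t,q)<0\}=\sup\{t:P^\mu(t,q)>0\}$.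 *)

theory Defs
  imports "HOL-Analysis.Analysis" "HOL-Probability.Probability_Measure"
begin

text \<open>The index set is a finite type \<^typ>\<open>'i\<close>. Finite words are lists, infinite words are functions on
  \<^typ>\<open>nat\<close>; the letter \<open>u\<^sub>1\<close> is \<open>u 0\<close>.\<close>

definition prefix_of :: "(nat \<Rightarrow> 'i) \<Rightarrow> nat \<Rightarrow> 'i list" where
  "prefix_of u n = map u [0..<n]"

definition cylinder :: "'i list \<Rightarrow> (nat \<Rightarrow> 'i) set" where
  "cylinder w = {v. prefix_of v (length w) = w}"

definition shift :: "(nat \<Rightarrow> 'i) \<Rightarrow> nat \<Rightarrow> 'i" where
  "shift u = (\<lambda>n. u (Suc n))"

text \<open>For \<open>u \<noteq> v\<close> the least index of disagreement is the length of the longest common prefix.\<close>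

definition word_dist :: "(nat \<Rightarrow> 'i) \<Rightarrow> (nat \<Rightarrow> 'i) \<Rightarrow> real" where
  "word_dist u v = (if u = v then 0 else (1/2) ^ (LEAST n. u n \<noteq> v n))"

lemma word_dist_le_iff:
  "word_dist u v \<le> (1/2) ^ n \<longleftrightarrow> (\<forall>k<n. u k = v k)"
proof (cases "u = v")
  case False
  then have ex: "\<exists>n. u n \<noteq> v n" by blast
  have "(1/2::real) ^ (LEAST n. u n \<noteq> v n) \<le> (1/2) ^ n \<longleftrightarrow> n \<le> (LEAST n. u n \<noteq> v n)"
    by (rule power_decreasing_iff) auto
  also have "\<dots> \<longleftrightarrow> (\<forall>k<n. u k = v k)"
    using LeastI_ex[OF ex] by (metis (mono_tags, lifting) not_less not_less_Least order_less_le_trans)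
  finally show ?thesis using False by (simp add: word_dist_def)
qed (simp add: word_dist_def)

lemma Metric_space_word_dist: "Metric_space UNIV word_dist"
proof
  fix u v w :: "nat \<Rightarrow> 'i"
  show "0 \<le> word_dist u v" by (simp add: word_dist_def)
  show "word_dist u v = word_dist v u" by (simp add: word_dist_def eq_commute)
  show "word_dist u v = 0 \<longleftrightarrow> u = v" by (simp add: word_dist_def)
  have ge0: "0 \<le> word_dist x y" for x y :: "nat \<Rightarrow> 'i" by (simp add: word_dist_def)
  have "word_dist u w \<le> max (word_dist u v) (word_dist v w)"
  proof (cases "u = v \<or> v = w")
    case True
    then show ?thesis by (auto simp: le_max_iff_disj)
  next
    case False
    define m where "m = min (LEAST n. u n \<noteq> v n) (LEAST n. v n \<noteq> w n)"
    have max_eq: "max (word_dist u v) (word_dist v w) = (1/2) ^ m"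
      using False by (auto simp: word_dist_def m_def min_def max_def power_decreasing_iff)
    have "u k = w k" if "k < m" for k
      using that not_less_Least[of k "\<lambda>n. u n \<noteq> v n"] not_less_Least[of k "\<lambda>n. v n \<noteq> w n"]
      by (simp add: m_def)
    then show ?thesis
      unfolding max_eq word_dist_le_iff by blast
  qed
  then show "word_dist u w \<le> word_dist u v + word_dist v w"
    using ge0[of u v] ge0[of v w] by linarith
qed

definition word_topology :: "(nat \<Rightarrow> 'i) topology" where
  "word_topology = Metric_space.mtopology UNIV word_dist"

definition word_borel :: "(nat \<Rightarrow> 'i) measure" where
  "word_borel = sigma UNIV {U. openin word_topology U}"

definition C1_on :: "(real ^ 'd) set \<Rightarrow> (real ^ 'd \<Rightarrow> real ^ 'd) \<Rightarrow> bool" where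
  "C1_on S f \<longleftrightarrow> (\<exists>f' :: real ^ 'd \<Rightarrow> (real ^ 'd) \<Rightarrow>\<^sub>L (real ^ 'd).
     (\<forall>x\<in>S. (f has_derivative blinfun_apply (f' x)) (at x)) \<and> continuous_on S f')"

definition conformal_linear :: "(real ^ 'd \<Rightarrow> real ^ 'd) \<Rightarrow> bool" where
  "conformal_linear L \<longleftrightarrow>
     (\<exists>r>0. \<exists>T. orthogonal_transformation T \<and> L = (\<lambda>v. r *\<^sub>R T v))"

text \<open>A diffeomorphism into \<open>V\<close> is one onto an open subset of \<open>V\<close>; surjectivity onto \<open>V\<close> is not required.\<close>

definition C1_conformal_diffeo_into :: "(real ^ 'd) set \<Rightarrow> (real ^ 'd \<Rightarrow> real ^ 'd) \<Rightarrow> bool" where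
  "C1_conformal_diffeo_into V f \<longleftrightarrow>
     f ` V \<subseteq> V \<and> open (f ` V) \<and> inj_on f V \<and> C1_on V f \<and> C1_on (f ` V) (inv_into V f) \<and>
     (\<forall>x\<in>V. conformal_linear (frechet_derivative f (at x)))"

primrec word_map :: "('i \<Rightarrow> 'a \<Rightarrow> 'a) \<Rightarrow> 'i list \<Rightarrow> 'a \<Rightarrow> 'a" where
  "word_map \<phi> [] = id"
| "word_map \<phi> (i # u) = \<phi> i \<circ> word_map \<phi> u"

definition deriv_norm :: "('i \<Rightarrow> real ^ 'd \<Rightarrow> real ^ 'd) \<Rightarrow> 'i list \<Rightarrow> real ^ 'd \<Rightarrow> real" where
  "deriv_norm \<phi> u x = onorm (frechet_derivative (word_map \<phi> u) (at x))"

text \<open>The total function \<open>\<phi> i\<close> is, on \<open>V\<close>, the conformal extension of the \<open>i\<close>th contraction of \<open>J\<close>;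
  its values outside \<open>V\<close> are irrelevant.\<close>

locale acifs =
  fixes J :: "(real ^ 'd) set"
    and \<phi> :: "'i::finite \<Rightarrow> real ^ 'd \<Rightarrow> real ^ 'd"
    and V :: "(real ^ 'd) set"
    and Jw :: "'i list \<Rightarrow> (real ^ 'd) set"
  assumes compact_J: "compact J"
    and interior_J: "interior J \<noteq> {}"
    and closure_interior_J: "closure (interior J) = J"
    and maps_J: "\<And>i. \<phi> i ` J \<subseteq> J"
    and closed_Jw: "\<And>u. closed (Jw u)"
    and Jw_subset: "\<And>u. Jw u \<subseteq> J"
    and Jw_Nil: "Jw [] = J"
    and contraction: "\<exists>c. 0 < c \<and> c < 1 \<and>
          (\<forall>i. \<forall>x\<in>J. \<forall>y\<in>J. norm (\<phi> i x - \<phi> i y) \<le> c * norm (x - y))"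
    and nested: "\<And>u i. Jw (u @ [i]) \<subseteq> Jw u"
    and translate: "\<And>u. \<exists>\<omega>. Jw u = (\<lambda>x. word_map \<phi> u x + \<omega>) ` J"
    and open_V: "open V"
    and connected_V: "connected V"
    and J_subset_V: "J \<subseteq> V"
    and conformal: "\<And>i. C1_conformal_diffeo_into V (\<phi> i)"
    and bounded_distortion: "\<exists>C\<ge>1. \<forall>u. \<forall>x\<in>V. \<forall>y\<in>V. deriv_norm \<phi> u x \<le> C * deriv_norm \<phi> u y"

definition open_set_condition :: "('i list \<Rightarrow> (real ^ 'd) set) \<Rightarrow> bool" where
  "open_set_condition Jw \<longleftrightarrow>
     (\<forall>u i j. i \<noteq> j \<longrightarrow> interior (Jw (u @ [i])) \<inter> interior (Jw (u @ [j])) = {})"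

definition gibbs_measure :: "(nat \<Rightarrow> 'i) measure \<Rightarrow> bool" where
  "gibbs_measure \<mu> \<longleftrightarrow> prob_space \<mu> \<and> sets \<mu> = sets word_borel \<and>
     (\<exists>(f :: (nat \<Rightarrow> 'i) \<Rightarrow> real) (P :: real) (a :: real).
        continuous_map word_topology euclideanreal f \<and> a > 0 \<and>
        (\<forall>u k. let r = measure \<mu> (cylinder (prefix_of u k)) /
                        exp (- real k * P + (\<Sum>j<k. f ((shift ^^ j) u)))
                in a \<le> r \<and> r \<le> 1 / a))"

text \<open>In an ACIFS the intersection below is a single point.\<close>

definition coding_map :: "('i list \<Rightarrow> (real ^ 'd) set) \<Rightarrow> (nat \<Rightarrow> 'i) \<Rightarrow> real ^ 'd" where
  "coding_map Jw u = (THE x. (\<Inter>n\<in>{1..}. Jw (prefix_of u n)) = {x})"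

definition image_measure ::
    "('i list \<Rightarrow> (real ^ 'd) set) \<Rightarrow> (nat \<Rightarrow> 'i) measure \<Rightarrow> (real ^ 'd) measure" where
  "image_measure Jw \<mu> = distr \<mu> borel (coding_map Jw)"

definition bounded_overlap :: "('i list \<Rightarrow> (real ^ 'd) set) \<Rightarrow> (nat \<Rightarrow> 'i) measure \<Rightarrow> bool" where
  "bounded_overlap Jw \<mu> \<longleftrightarrow> (\<exists>C::real. C \<ge> 1 \<and>
     (\<forall>u. inverse C * measure (image_measure Jw \<mu>) (Jw u) \<le> measure \<mu> (cylinder u) \<and>
          measure \<mu> (cylinder u) \<le> C * measure (image_measure Jw \<mu>) (Jw u)))"

definition mesh_cube :: "real \<Rightarrow> int ^ 'd \<Rightarrow> (real ^ 'd) set" where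
  "mesh_cube \<delta> m = {x. \<forall>j. of_int (m $ j) * \<delta> \<le> x $ j \<and> x $ j < (of_int (m $ j) + 1) * \<delta>}"

text \<open>Indexing by \<open>m\<close> counts every cube once when \<open>\<delta> > 0\<close>. The sum is taken in \<^typ>\<open>ennreal\<close>
  because for \<open>q < 1\<close> it may diverge for a finite measure with unbounded support.\<close>

definition mesh_sum :: "(real ^ 'd) measure \<Rightarrow> real \<Rightarrow> real \<Rightarrow> ennreal" where
  "mesh_sum \<nu> q \<delta> = (\<Sum>\<^sub>\<infinity>m\<in>UNIV. ennreal (measure \<nu> (mesh_cube \<delta> m) powr q))"

definition ext_ln :: "ennreal \<Rightarrow> ereal" where
  "ext_ln s = (if s = 0 then -\<infinity> else if s = \<infinity> then \<infinity> else ereal (ln (enn2real s)))"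

definition dim_quotient :: "(real ^ 'd) measure \<Rightarrow> real \<Rightarrow> real \<Rightarrow> ereal" where
  "dim_quotient \<nu> q \<delta> = ext_ln (mesh_sum \<nu> q \<delta>) / ereal ((q - 1) * ln \<delta>)"

definition lower_gen_dim :: "(real ^ 'd) measure \<Rightarrow> real \<Rightarrow> ereal" where
  "lower_gen_dim \<nu> q = Liminf (at_right 0) (dim_quotient \<nu> q)"

definition upper_gen_dim :: "(real ^ 'd) measure \<Rightarrow> real \<Rightarrow> ereal" where
  "upper_gen_dim \<nu> q = Limsup (at_right 0) (dim_quotient \<nu> q)"

definition has_gen_dim :: "(real ^ 'd) measure \<Rightarrow> real \<Rightarrow> ereal \<Rightarrow> bool" where
  "has_gen_dim \<nu> q D \<longleftrightarrow> lower_gen_dim \<nu> q = D \<and> upper_gen_dim \<nu> q = D"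

definition pressure :: "(real ^ 'd) set \<Rightarrow> ('i::finite \<Rightarrow> real ^ 'd \<Rightarrow> real ^ 'd) \<Rightarrow>
    (nat \<Rightarrow> 'i) measure \<Rightarrow> real \<Rightarrow> real \<Rightarrow> real" where
  "pressure J \<phi> \<mu> t q = lim (\<lambda>k. sgn (1 - q) / real k *
     ln (\<Sum>u | length u = k. (SUP x\<in>J. deriv_norm \<phi> u x) powr (t * (1 - q)) *
                             measure \<mu> (cylinder u) powr q))"

text \<open>For an ACIFS and a Gibbs measure the limit defining the pressure exists, and this infimum
  equals the supremum of the \<open>t\<close> with positive pressure (in particular it is an infimum of a
  non-empty set that is bounded below).\<close>

definition d_crit :: "(real ^ 'd) set \<Rightarrow> ('i::finite \<Rightarrow> real ^ 'd \<Rightarrow> real ^ 'd) \<Rightarrow>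
    (nat \<Rightarrow> 'i) measure \<Rightarrow> real \<Rightarrow> real" where
  "d_crit J \<phi> \<mu> q = Inf {t. pressure J \<phi> \<mu> t q < 0}"

end

theory Submission
  imports Defs "HOL-Library.Sublist"
begin

text \<open>
  Write \<open>r\<^sub>u = \<parallel>D\<phi>\<^sub>u\<parallel>\<close> and \<open>m\<^sub>u = \<mu>[u]\<^sup>q\<close>. Bounded distortion and the Gibbs property make every weight
  \<open>g\<^sub>u = r\<^sub>u\<^sup>s m\<^sub>u\<close> multiplicative up to a constant factor, so its sums over the words of length \<open>k\<close> are
  comparable to \<open>exp (k p(s))\<close>, where \<open>p\<close> is strictly decreasing with a single zero \<open>s\<close>. At this zero the
  sum of \<open>g\<close> over any cut set of the word tree is comparable to \<open>1\<close>. For the cut \<open>r\<^sub>u \<approx> \<delta>\<close> this says that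
  the sum of the \<open>m\<^sub>u\<close> is comparable to \<open>\<delta> powr -s\<close>. Since the sets \<open>J\<^sub>u\<close> of this cut have diameter at most a
  multiple of \<open>\<delta>\<close> and contain disjoint balls of radius comparable to \<open>\<delta>\<close>, each of them meets boundedly
  many \<open>\<delta>\<close>-mesh cubes and vice versa, so the mesh sum is comparable to \<open>\<delta> powr -s\<close> as well and
  \<open>D\<^sub>q = s / (1 - q) = d\<^sub>q\<close>.
\<close>

subsection \<open>Quasi-multiplicative weights on words\<close>

text \<open>The translations are arbitrary, so the image measure has no self-similarity in space to
  exploit. Every multiplicative argument is therefore made on words, and the sets
  \<open>Jw u\<close> enter only through their diameters, the balls inside them and the disjointness
  of their interiors. Errors are kept as bounded additive terms in the logarithm. This says more
  than an exponential rate: at the zero of p the sums over the words of length n lie between two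
  positive constants. Grouping these words by their prefix u in a cut expresses such a sum, up to a
  factor, as a sum of g(u) times a shorter level sum, and this is why the cut sum is bounded above
  and below. The exponent s stands for t (1 - q). In this variable the growth rate decreases for q <
  1 and q > 1 alike, and the sign of 1 - q matters only on returning to t. The passage to mesh cubes
  does not separate the two cases either: the q-th power of a sum of at most N terms is at most N^q
  times the largest q-th power.\<close>

definition quasi_multiplicative :: "real \<Rightarrow> ('i list \<Rightarrow> real) \<Rightarrow> bool" where
  "quasi_multiplicative B g \<longleftrightarrow>
     (\<forall>u. g u > 0) \<and> (\<forall>u v. \<bar>ln (g (u @ v)) - ln (g u) - ln (g v)\<bar> \<le> B)"

lemma quasi_multiplicative_pos: "quasi_multiplicative B g \<Longrightarrow> g u > 0"
  by (simp add: quasi_multiplicative_def)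

lemma quasi_multiplicative_times:
  assumes "quasi_multiplicative B g" "quasi_multiplicative B' h"
  shows "quasi_multiplicative (B + B') (\<lambda>u. g u * h u)"
proof -
  have pos: "g u > 0" "h u > 0" for u
    using assms by (simp_all add: quasi_multiplicative_pos)
  have "\<bar>ln (g (u @ v) * h (u @ v)) - ln (g u * h u) - ln (g v * h v)\<bar> \<le> B + B'" for u v
  proof -
    have "\<bar>ln (g (u @ v)) - ln (g u) - ln (g v)\<bar> \<le> B" "\<bar>ln (h (u @ v)) - ln (h u) - ln (h v)\<bar> \<le> B'"
      using assms by (simp_all add: quasi_multiplicative_def)
    then show ?thesis unfolding ln_mult_pos[OF pos] by linarith
  qed
  then show ?thesis using pos by (simp add: quasi_multiplicative_def)
qed

lemma quasi_multiplicative_powr: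
  assumes "quasi_multiplicative B g"
  shows "quasi_multiplicative (\<bar>s\<bar> * B) (\<lambda>u. g u powr s)"
proof -
  have pos: "g u > 0" for u using assms by (rule quasi_multiplicative_pos)
  have "\<bar>ln (g (u @ v) powr s) - ln (g u powr s) - ln (g v powr s)\<bar> \<le> \<bar>s\<bar> * B" for u v
  proof -
    have "ln (g (u @ v) powr s) - ln (g u powr s) - ln (g v powr s) =
        s * (ln (g (u @ v)) - ln (g u) - ln (g v))"
      using pos[of u] pos[of v] pos[of "u @ v"] by (simp add: ln_powr algebra_simps)
    moreover have "\<bar>ln (g (u @ v)) - ln (g u) - ln (g v)\<bar> \<le> B"
      using assms by (simp add: quasi_multiplicative_def)
    ultimately show ?thesis by (simp add: abs_mult mult_left_mono)
  qed
  then show ?thesis using pos by (simp add: quasi_multiplicative_def order_less_imp_not_eq2)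
qed

lemma quasi_multiplicative_append:
  assumes "quasi_multiplicative B g"
  shows "g (u @ v) \<le> exp B * (g u * g v)" "exp (- B) * (g u * g v) \<le> g (u @ v)"
proof -
  have pos: "g u > 0" for u using assms by (rule quasi_multiplicative_pos)
  have "\<bar>ln (g (u @ v)) - ln (g u) - ln (g v)\<bar> \<le> B"
    using assms by (simp add: quasi_multiplicative_def)
  then have "ln (g (u @ v)) \<le> ln (exp B * (g u * g v))" "ln (exp (-B) * (g u * g v)) \<le> ln (g (u @ v))"
    using pos[of u] pos[of v] by (auto simp: ln_mult)
  then show "g (u @ v) \<le> exp B * (g u * g v)" "exp (- B) * (g u * g v) \<le> g (u @ v)"
    using pos[of u] pos[of v] pos[of "u @ v"] by (subst (asm) ln_le_cancel_iff; simp)+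
qed

lemma quasi_multiplicativeI:
  assumes "K > 0" "\<And>u. g u > 0"
    and "\<And>u v. g (u @ v) \<le> K * (g u * g v)" "\<And>u v. g u * g v \<le> K * g (u @ v)"
  shows "quasi_multiplicative (ln K) g"
proof -
  have "\<bar>ln (g (u @ v)) - ln (g u) - ln (g v)\<bar> \<le> ln K" for u v
  proof -
    have "ln (g (u @ v)) \<le> ln (K * (g u * g v))" "ln (g u * g v) \<le> ln (K * g (u @ v))"
      using assms by (simp_all add: ln_mono mult_pos_pos)
    then show ?thesis using assms(1) assms(2)[of u] assms(2)[of v] assms(2)[of "u @ v"]
      by (simp add: ln_mult)
  qed
  then show ?thesis using assms by (simp add: quasi_multiplicative_def)
qed

text \<open>Each appended letter costs a fixed factor, and the finite alphabet provides a smallest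
  one. This bound later keeps the growth rate Lipschitz in the exponent.\<close>

lemma quasi_multiplicative_exp_lower:
  fixes g :: "'i::finite list \<Rightarrow> real"
  assumes "quasi_multiplicative B g"
  obtains b where "b > 0" "\<And>u. g [] * b ^ length u \<le> g u"
proof -
  have pos: "g u > 0" for u using assms by (rule quasi_multiplicative_pos)
  define b where "b = exp (-B) * Min (range (\<lambda>i. g [i]))"
  have "b > 0" using pos by (simp add: b_def)
  have "g [] * b ^ length u \<le> g u" for u
  proof (induction u rule: rev_induct)
    case (snoc i u)
    have "g [] * b ^ length (u @ [i]) \<le> g u * b" using snoc \<open>b > 0\<close> by (simp add: mult_ac)
    also have "\<dots> \<le> g u * (exp (-B) * g [i])"
      using pos[of u] by (simp add: b_def)
    also have "\<dots> \<le> g (u @ [i])" using quasi_multiplicative_append(2)[OF assms, of u "[i]"]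
      by (simp add: mult_ac)
    finally show ?case .
  qed simp
  with \<open>b > 0\<close> show ?thesis by (rule that)
qed

text \<open>Two-sided form of Fekete's argument: a (n * k) is compared with n copies of a k and with
  k copies of a n. The bounded defect yields, besides the limit, an error that stays bounded in k
  instead of being only o(k).\<close>

lemma almost_additive_limit:
  fixes a :: "nat \<Rightarrow> real"
  assumes "\<And>k l. \<bar>a (k + l) - a k - a l\<bar> \<le> B"
  obtains p where "(\<lambda>k. a k / real k) \<longlonglongrightarrow> p" "\<And>k. \<bar>a k - real k * p\<bar> \<le> B"
proof -
  have B0: "B \<ge> 0" using assms[of 0 0] by linarith
  have mult: "\<bar>a (n * k) - real n * a k\<bar> \<le> real n * B" if "n \<ge> 1" for n k
    using that
  proof (induction n rule: dec_induct)
    case base then show ?case using B0 by simp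
  next
    case (step n)
    then show ?case using assms[of k "n * k"] by (simp add: algebra_simps abs_le_iff)
  qed
  have mult': "\<bar>a (n * k) / real (n * k) - a k / real k\<bar> \<le> B / real k" if "n \<ge> 1" "k \<ge> 1" for n k
  proof -
    have "\<bar>a (n * k) / real (n * k) - a k / real k\<bar> = \<bar>a (n * k) - real n * a k\<bar> / real (n * k)"
      using that by (simp add: field_simps abs_divide)
    also have "\<dots> \<le> (real n * B) / real (n * k)"
      by (intro divide_right_mono mult[OF that(1)]) simp
    finally show ?thesis using that by simp
  qed
  \<comment> \<open>Both quotients are close to the one at n * k = k * n, which drops out.\<close>
  have cmp: "\<bar>a n / real n - a k / real k\<bar> \<le> B / real k + B / real n" if "n \<ge> 1" "k \<ge> 1" for n k
    using mult'[of n k] mult'[of k n] that by (simp add: mult.commute)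
  have "Cauchy (\<lambda>k. a k / real k)"
  proof (rule metric_CauchyI)
    fix e :: real assume "e > 0"
    obtain N where N: "real N > 2 * B / e" using reals_Archimedean2 by blast
    have small: "B / real n < e / 2" if "n \<ge> max N 1" for n
    proof -
      have "2 * B / e < real n" using N that by (simp add: less_le_trans)
      then show ?thesis using \<open>e > 0\<close> that by (simp add: field_simps)
    qed
    have "dist (a m / real m) (a n / real n) < e" if "m \<ge> max N 1" "n \<ge> max N 1" for m n
    proof -
      have "\<bar>a m / real m - a n / real n\<bar> \<le> B / real n + B / real m"
        using cmp[of m n] that by simp
      also have "\<dots> < e / 2 + e / 2" using small[OF that(1)] small[OF that(2)] by linarith
      finally show ?thesis by (simp add: dist_real_def)
    qed
    then show "\<exists>M. \<forall>m\<ge>M. \<forall>n\<ge>M. dist (a m / real m) (a n / real n) < e" by blast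
  qed
  then obtain p where p: "(\<lambda>k. a k / real k) \<longlonglongrightarrow> p"
    using Cauchy_convergent convergent_def by blast
  have "\<bar>a k - real k * p\<bar> \<le> B" for k
  proof (cases "k = 0")
    case True then show ?thesis using assms[of 0 0] by simp
  next
    case False
    \<comment> \<open>Letting n tend to infinity removes B / n; multiplying by k then turns B / k
      into B.\<close>
    have "(\<lambda>n. \<bar>a n / real n - a k / real k\<bar>) \<longlonglongrightarrow> \<bar>p - a k / real k\<bar>"
      by (intro tendsto_intros p)
    moreover have "(\<lambda>n. B / real k + B / real n) \<longlonglongrightarrow> B / real k + 0"
      by (intro tendsto_intros lim_const_over_n)
    moreover have "\<forall>\<^sub>F n in sequentially. \<bar>a n / real n - a k / real k\<bar> \<le> B / real k + B / real n"
      using eventually_ge_at_top[of 1] by eventually_elim (use cmp False in auto)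
    ultimately have "\<bar>p - a k / real k\<bar> \<le> B / real k + 0"
      by (intro tendsto_le[OF trivial_limit_sequentially])
    then have "real k * \<bar>p - a k / real k\<bar> \<le> B" using False by (simp add: field_simps)
    moreover have "real k * \<bar>p - a k / real k\<bar> = \<bar>real k * p - a k\<bar>"
      using False by (simp add: abs_mult_pos' algebra_simps)
    ultimately show ?thesis by (simp add: abs_minus_commute)
  qed
  with p show ?thesis by (rule that)
qed

section \<open>Level sums, cut sets and growth rates\<close>

lemma finite_words_length: "finite {u :: 'i::finite list. length u = n}"
  using finite_lists_length_eq[of "UNIV :: 'i set" n] by simp

definition level_sum :: "('i list \<Rightarrow> real) \<Rightarrow> nat \<Rightarrow> real" where
  "level_sum g n = (\<Sum>u | length u = n. g u)"

lemma level_sum_pos: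
  fixes g :: "'i::finite list \<Rightarrow> real"
  assumes "\<And>u. g u > 0"
  shows "level_sum g n > 0"
proof -
  have "replicate n undefined \<in> {u :: 'i list. length u = n}" by simp
  then show ?thesis unfolding level_sum_def
    by (intro sum_pos finite_words_length assms) blast+
qed

text \<open>A maximal antichain of the word tree, tested at depth n only: unique existence of the
  prefix length k expresses covering and incomparability together.\<close>

definition is_cut :: "nat \<Rightarrow> 'i list set \<Rightarrow> bool" where
  "is_cut n A \<longleftrightarrow> (\<forall>u\<in>A. length u \<le> n) \<and> (\<forall>w. length w = n \<longrightarrow> (\<exists>!k. k \<le> n \<and> take k w \<in> A))"

lemma is_cut_finite: "is_cut n (A :: 'i::finite list set) \<Longrightarrow> finite A"
  using finite_subset[OF _ finite_lists_length_le[of "UNIV :: 'i set" n], of A]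
  by (auto simp: is_cut_def)

text \<open>Stated at depth k + l so that the general cut estimates specialize to almost
  multiplicativity of the level sums.\<close>

lemma is_cut_level: "is_cut (k + l) {u. length u = k}"
  unfolding is_cut_def by (auto intro!: ex1I[of _ k])

text \<open>Concatenation is a bijection from the pairs of a cut word and a tail of the missing
  length onto the words of length n.\<close>

lemma level_sum_cut:
  fixes g :: "'i::finite list \<Rightarrow> real"
  assumes "is_cut n A"
  shows "level_sum g n = (\<Sum>u\<in>A. \<Sum>v | length v = n - length u. g (u @ v))"
proof -
  have len: "length u \<le> n" if "u \<in> A" for u using assms that by (simp add: is_cut_def)
  have ex1: "\<exists>!k. k \<le> n \<and> take k w \<in> A" if "length w = n" for w
    using assms that by (simp add: is_cut_def)
  let ?S = "Sigma A (\<lambda>u. {v. length v = n - length u})"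
  have bij: "bij_betw (\<lambda>(u, v). u @ v) ?S {w. length w = n}"
    unfolding bij_betw_def
  proof
    show "inj_on (\<lambda>(u, v). u @ v) ?S"
    proof (clarsimp simp: inj_on_def)
      fix u v u' v' assume uv: "u \<in> A" "length v = n - length u" "u' \<in> A" "length v' = n - length u'"
        "u @ v = u' @ v'"
      have "length (u @ v) = n" using len[OF uv(1)] uv(2) by simp
      moreover have "take (length u) (u @ v) \<in> A" using uv(1) by simp
      moreover have "take (length u') (u @ v) \<in> A" unfolding uv(5) using uv(3) by simp
      ultimately have "length u = length u'"
        using ex1[of "u @ v"] len[OF uv(1)] len[OF uv(3)] by (metis (no_types, lifting))
      with uv(5) show "u = u' \<and> v = v'" by simp
    qed
    show "(\<lambda>(u, v). u @ v) ` ?S = {w. length w = n}"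
    proof (intro set_eqI iffI)
      fix w :: "'i list" assume "w \<in> {w. length w = n}"
      then obtain k where "k \<le> n" "take k w \<in> A" using ex1[of w] by auto
      then have "(take k w, drop k w) \<in> ?S" "w = (\<lambda>(u, v). u @ v) (take k w, drop k w)"
        using \<open>w \<in> {w. length w = n}\<close> by auto
      then show "w \<in> (\<lambda>(u, v). u @ v) ` ?S" by blast
    qed (use len in auto)
  qed
  have "level_sum g n = (\<Sum>(u, v)\<in>?S. g (u @ v))"
    unfolding level_sum_def using sum.reindex_bij_betw[OF bij, of g] by (simp add: case_prod_unfold)
  also have "\<dots> = (\<Sum>u\<in>A. \<Sum>v | length v = n - length u. g (u @ v))"
    by (rule sum.Sigma[symmetric]) (auto intro: is_cut_finite[OF assms] finite_words_length)
  finally show ?thesis .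
qed

lemma level_sum_cut_bounds:
  fixes g :: "'i::finite list \<Rightarrow> real"
  assumes "quasi_multiplicative B g" "is_cut n A"
  shows "level_sum g n \<le> exp B * (\<Sum>u\<in>A. g u * level_sum g (n - length u))"
    and "exp (- B) * (\<Sum>u\<in>A. g u * level_sum g (n - length u)) \<le> level_sum g n"
proof -
  have *: "x * (\<Sum>u\<in>A. g u * level_sum g (n - length u)) =
      (\<Sum>u\<in>A. \<Sum>v | length v = n - length u. x * (g u * g v))" for x
    by (simp add: level_sum_def sum_distrib_left)
  show "level_sum g n \<le> exp B * (\<Sum>u\<in>A. g u * level_sum g (n - length u))"
    unfolding * level_sum_cut[OF assms(2)]
    by (rule sum_mono, rule sum_mono, rule quasi_multiplicative_append[OF assms(1)])
  show "exp (- B) * (\<Sum>u\<in>A. g u * level_sum g (n - length u)) \<le> level_sum g n"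
    unfolding * level_sum_cut[OF assms(2)]
    by (rule sum_mono, rule sum_mono, rule quasi_multiplicative_append[OF assms(1)])
qed

lemma level_sum_almost_multiplicative:
  fixes g :: "'i::finite list \<Rightarrow> real"
  assumes "quasi_multiplicative B g"
  shows "\<bar>ln (level_sum g (k + l)) - ln (level_sum g k) - ln (level_sum g l)\<bar> \<le> B"
proof -
  let ?Z = "level_sum g"
  have pos: "?Z n > 0" for n using level_sum_pos[of g] quasi_multiplicative_pos[OF assms] by blast
  have *: "(\<Sum>u | length u = k. g u * ?Z (k + l - length u)) = ?Z k * ?Z l"
    by (simp add: level_sum_def sum_distrib_right)
  have "?Z (k + l) \<le> exp B * (?Z k * ?Z l)" "exp (- B) * (?Z k * ?Z l) \<le> ?Z (k + l)"
    using level_sum_cut_bounds[OF assms is_cut_level[of k l]] by (simp_all only: *)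
  then have "ln (?Z (k + l)) \<le> ln (exp B * (?Z k * ?Z l))" "ln (exp (- B) * (?Z k * ?Z l)) \<le> ln (?Z (k + l))"
    using pos by (simp_all add: ln_mono)
  then show ?thesis using pos[of k] pos[of l] by (simp add: ln_mult)
qed

definition growth_rate :: "('i list \<Rightarrow> real) \<Rightarrow> real" where
  "growth_rate g = lim (\<lambda>k. ln (level_sum g k) / real k)"

lemma growth_rate:
  fixes g :: "'i::finite list \<Rightarrow> real"
  assumes "quasi_multiplicative B g"
  shows growth_rate_tendsto: "(\<lambda>k. ln (level_sum g k) / real k) \<longlonglongrightarrow> growth_rate g"
    and growth_rate_bound: "\<bar>ln (level_sum g k) - real k * growth_rate g\<bar> \<le> B"
proof -
  obtain p where p: "(\<lambda>k. ln (level_sum g k) / real k) \<longlonglongrightarrow> p"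
    "\<And>k. \<bar>ln (level_sum g k) - real k * p\<bar> \<le> B"
    using almost_additive_limit[OF level_sum_almost_multiplicative[OF assms]] by metis
  moreover have "growth_rate g = p" unfolding growth_rate_def using p(1) by (rule limI)
  ultimately show "(\<lambda>k. ln (level_sum g k) / real k) \<longlonglongrightarrow> growth_rate g"
    "\<bar>ln (level_sum g k) - real k * growth_rate g\<bar> \<le> B" by simp_all
qed

text \<open>The constant \<alpha> disappears after division by k, so only the rate \<beta> shifts
  the growth rate.\<close>

lemma growth_rate_le:
  fixes g h :: "'i::finite list \<Rightarrow> real"
  assumes g: "quasi_multiplicative B g" and h: "quasi_multiplicative B' h"
    and le: "\<And>u. h u \<le> exp (\<alpha> + \<beta> * real (length u)) * g u"
  shows "growth_rate h \<le> growth_rate g + \<beta>"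
proof (rule tendsto_le[OF trivial_limit_sequentially _ growth_rate_tendsto[OF h]])
  show "(\<lambda>k. ln (level_sum g k) / real k + (\<alpha> / real k + \<beta>)) \<longlonglongrightarrow> growth_rate g + \<beta>"
    using tendsto_add[OF growth_rate_tendsto[OF g] tendsto_add[OF lim_const_over_n[of \<alpha>] tendsto_const[of \<beta>]]]
    by simp
  show "\<forall>\<^sub>F k in sequentially.
      ln (level_sum h k) / real k \<le> ln (level_sum g k) / real k + (\<alpha> / real k + \<beta>)"
    using eventually_ge_at_top[of 1]
  proof eventually_elim
    case (elim k)
    have pos: "level_sum g k > 0" "level_sum h k > 0"
      using level_sum_pos quasi_multiplicative_pos[OF g] quasi_multiplicative_pos[OF h] by blast+
    have "level_sum h k \<le> (\<Sum>u | length u = k. exp (\<alpha> + \<beta> * real k) * g u)"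
      unfolding level_sum_def using le by (intro sum_mono) auto
    also have "\<dots> = exp (\<alpha> + \<beta> * real k) * level_sum g k"
      by (simp add: level_sum_def sum_distrib_left)
    finally have "ln (level_sum h k) \<le> ln (exp (\<alpha> + \<beta> * real k) * level_sum g k)"
      using pos by (simp add: ln_mono)
    then have "ln (level_sum h k) \<le> ln (level_sum g k) + \<alpha> + \<beta> * real k"
      using pos by (simp add: ln_mult)
    then have "ln (level_sum h k) / real k \<le> (ln (level_sum g k) + \<alpha> + \<beta> * real k) / real k"
      by (rule divide_right_mono) simp
    then show ?case using elim by (simp add: add_divide_distrib)
  qed
qed

text \<open>With growth rate zero, \<open>growth_rate_bound\<close> confines every level sum to the
  interval from exp (-B) to exp B. One factor comes from the level sum at depth n, one from the
  tails and one from splitting the words at the cut; hence 3 * B.\<close>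

lemma cut_sum_bounds:
  fixes g :: "'i::finite list \<Rightarrow> real"
  assumes g: "quasi_multiplicative B g" and 0: "growth_rate g = 0" and cut: "is_cut n A"
  shows "exp (- 3 * B) \<le> sum g A" and "sum g A \<le> exp (3 * B)"
proof -
  let ?Z = "level_sum g"
  have gpos: "g u > 0" for u using g by (rule quasi_multiplicative_pos)
  have pos: "?Z n > 0" for n using level_sum_pos[of g] gpos by blast
  have "\<bar>ln (?Z k)\<bar> \<le> B" for k using growth_rate_bound[OF g, of k] 0 by simp
  then have Z: "?Z k \<le> exp B" "exp (-B) \<le> ?Z k" for k
    using pos[of k] by (metis abs_le_D1 exp_le_cancel_iff exp_ln, 
        metis abs_le_D2 exp_le_cancel_iff exp_ln minus_le_iff)
  have "exp (-B) * (exp (-B) * sum g A) \<le> exp (- B) * (\<Sum>u\<in>A. g u * ?Z (n - length u))"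
    unfolding sum_distrib_left[of "exp (-B)" g]
    using Z(2) gpos by (intro mult_left_mono sum_mono) (auto simp: mult.commute mult_le_cancel_left_pos)
  also have "\<dots> \<le> exp B" using level_sum_cut_bounds(2)[OF g cut] Z(1) order_trans by blast
  finally have "exp (2 * B) * (exp (- B) * (exp (- B) * sum g A)) \<le> exp (2 * B) * exp B" by simp
  moreover have "exp (2 * B) * (exp (- B) * exp (- B)) = 1" "exp (2 * B) * exp B = exp (3 * B)"
    by (simp_all flip: exp_add)
  ultimately show "sum g A \<le> exp (3 * B)" by (simp flip: mult.assoc)
  have "exp (-B) \<le> exp B * (\<Sum>u\<in>A. g u * ?Z (n - length u))"
    using level_sum_cut_bounds(1)[OF g cut] Z(2) order_trans by blast
  also have "\<dots> \<le> exp B * (exp B * sum g A)"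
    unfolding sum_distrib_left[of "exp B" g]
    using Z(1) gpos by (intro mult_left_mono sum_mono) (auto simp: mult.commute mult_le_cancel_left_pos)
  finally have "exp (-2 * B) * exp (-B) \<le> exp (-2 * B) * (exp B * (exp B * sum g A))" by simp
  moreover have "exp (-2 * B) * (exp B * (exp B * x)) = x" for x
    by (simp flip: exp_add mult.assoc)
  moreover have "exp (-2 * B) * exp (-B) = exp (-3 * B)" by (simp flip: exp_add)
  ultimately show "exp (- 3 * B) \<le> sum g A" by metis
qed

section \<open>Stopping words: the first drop of a weight to a threshold\<close>

definition stopping_words :: "('i list \<Rightarrow> real) \<Rightarrow> real \<Rightarrow> 'i list set" where
  "stopping_words r \<delta> = {u. r u \<le> \<delta> \<and> (\<forall>k < length u. \<delta> < r (take k u))}"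

text \<open>The weight r need not be monotone along prefixes. Uniqueness rests on the requirement
  that all proper prefixes exceed \<delta>, which singles out the first drop.\<close>

lemma stopping_words_ex1:
  assumes "r (take n w) \<le> \<delta>" "n \<le> length w"
  shows "\<exists>!k. k \<le> n \<and> take k w \<in> stopping_words r \<delta>"
proof -
  define k where "k = (LEAST k. r (take k w) \<le> \<delta>)"
  have k: "r (take k w) \<le> \<delta>" "k \<le> n"
    unfolding k_def using assms LeastI[of "\<lambda>k. r (take k w) \<le> \<delta>"] by (auto intro: Least_le)
  have less: "\<delta> < r (take j w)" if "j < k" for j
    using not_less_Least[of j "\<lambda>k. r (take k w) \<le> \<delta>"] that by (simp add: k_def)
  show ?thesis
  proof (rule ex1I[of _ k])
    show "k \<le> n \<and> take k w \<in> stopping_words r \<delta>"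
      using k less assms(2) by (auto simp: stopping_words_def)
    fix j assume j: "j \<le> n \<and> take j w \<in> stopping_words r \<delta>"
    then have *: "r (take j w) \<le> \<delta>" "\<And>i. i < j \<Longrightarrow> \<delta> < r (take i w)"
      using assms(2) by (auto simp: stopping_words_def min_def split: if_splits)
    then show "j = k" using less[of j] *(2)[of k] k(1) by (meson linorder_neqE_nat not_le)
  qed
qed

lemma is_cut_stopping_words:
  assumes "\<And>w. length w = n \<Longrightarrow> r w \<le> \<delta>"
  shows "is_cut n (stopping_words r \<delta>)"
  unfolding is_cut_def
proof (intro conjI ballI allI impI)
  fix u assume "u \<in> stopping_words r \<delta>"
  \<comment> \<open>In a longer word the prefix of length n would be a proper prefix that has
    already dropped to \<delta>.\<close>
  then show "length u \<le> n"
    using assms[of "take n u"] by (force simp: stopping_words_def not_less[symmetric])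
next
  fix w :: "'a list" assume "length w = n"
  then show "\<exists>!k. k \<le> n \<and> take k w \<in> stopping_words r \<delta>"
    using stopping_words_ex1[of r n w \<delta>] assms by simp
qed

section \<open>The critical exponent\<close>

lemma strictly_decreasing_zero:
  fixes p :: "real \<Rightarrow> real"
  assumes neg: "\<beta> < 0"
    and upper: "\<And>s t. s < t \<Longrightarrow> p t \<le> p s + (t - s) * \<beta>"
    and lower: "\<And>s t. s < t \<Longrightarrow> p s + (t - s) * \<gamma> \<le> p t"
  obtains s0 where "p s0 = 0" "\<And>s. p s < 0 \<longleftrightarrow> s0 < s" "\<And>s. p s > 0 \<longleftrightarrow> s < s0"
proof -
  \<comment> \<open>The upper slope makes p decreasing and the lower slope limits the decrease;
    together they make p Lipschitz, so the intermediate value theorem applies.\<close>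
  have lip: "\<bar>p t - p s\<bar> \<le> \<bar>\<gamma>\<bar> * \<bar>t - s\<bar>" if "s < t" for s t
  proof -
    have "(t - s) * \<beta> \<le> 0" using neg that by (simp add: mult_nonneg_nonpos)
    moreover have "(t - s) * (- \<bar>\<gamma>\<bar>) \<le> (t - s) * \<gamma>" using that by (intro mult_left_mono) auto
    ultimately show ?thesis using lower[OF that] upper[OF that] that by (simp add: algebra_simps)
  qed
  have lip: "dist (p t) (p s) \<le> \<bar>\<gamma>\<bar> * dist t s" for s t
    using lip[of s t] lip[of t s] by (cases s t rule: linorder_cases) (auto simp: dist_real_def abs_minus_commute)
  have cont: "isCont p s" for s
  proof -
    have "((\<lambda>t. \<bar>\<gamma>\<bar> * dist t s) \<longlongrightarrow> \<bar>\<gamma>\<bar> * dist s s) (at s)" by (intro tendsto_intros)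
    then have "((\<lambda>t. \<bar>\<gamma>\<bar> * dist t s) \<longlongrightarrow> 0) (at s)" by simp
    then have "((\<lambda>t. dist (p t) (p s)) \<longlongrightarrow> 0) (at s)"
      by (rule Lim_null_comparison[rotated]) (simp add: lip)
    then show ?thesis unfolding isCont_def by (subst tendsto_dist_iff)
  qed
  \<comment> \<open>The line through (0, p 0) with slope \<beta> vanishes at T. To the right of 0
    the function p is at most this line and to the left at least it, so p has a zero between 0 and
    T.\<close>
  define T where "T = - p 0 / \<beta>"
  have T: "T * \<beta> = - p 0" using neg by (simp add: T_def)
  have "\<exists>s. p s = 0"
  proof (cases "p 0" "0 :: real" rule: linorder_cases)
    case less
    then have "T < 0" using neg by (simp add: T_def divide_neg_neg)
    then have "p T \<ge> 0" using upper[of T 0] T less by (simp add: algebra_simps)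
    then show ?thesis using IVT2[of p 0 0 T] cont less \<open>T < 0\<close> by force
  next
    case greater
    then have "0 < T" using neg by (simp add: T_def divide_pos_neg)
    then have "p T \<le> 0" using upper[of 0 T] T by simp
    then show ?thesis using IVT2[of p T 0 0] cont greater \<open>0 < T\<close> by force
  next
    case equal
    then show ?thesis by (rule exI)
  qed
  then obtain s0 where s0: "p s0 = 0" by blast
  have dec: "p t < p s" if "s < t" for s t
    using upper[OF that] neg that by (smt (verit) mult_pos_neg)
  show ?thesis
  proof (rule that[of s0])
    show "p s < 0 \<longleftrightarrow> s0 < s" "p s > 0 \<longleftrightarrow> s < s0" for s
      using dec[of s s0] dec[of s0 s] s0 by (cases s s0 rule: linorder_cases; simp)+
  qed (rule s0)
qed

text \<open>Raising s multiplies the weight by a power of r u, and r u lies between two exponentials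
  in the length of u. The growth rate therefore has slopes between ln b and ln c < 0.\<close>

lemma critical_exponent:
  fixes r m :: "'i::finite list \<Rightarrow> real"
  assumes r: "quasi_multiplicative B r" and m: "quasi_multiplicative B' m"
    and decay: "0 < c" "c < 1" "\<And>u. r u \<le> D * c ^ length u"
  obtains s0 where "growth_rate (\<lambda>u. r u powr s0 * m u) = 0"
    "\<And>s. growth_rate (\<lambda>u. r u powr s * m u) < 0 \<longleftrightarrow> s0 < s"
    "\<And>s. growth_rate (\<lambda>u. r u powr s * m u) > 0 \<longleftrightarrow> s < s0"
proof -
  have rpos: "r u > 0" and mpos: "m u > 0" for u
    using quasi_multiplicative_pos r m by blast+
  obtain b where b: "b > 0" "\<And>u. r [] * b ^ length u \<le> r u"
    using quasi_multiplicative_exp_lower[OF r] by blast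
  have D: "D > 0" using decay(3)[of "[]"] rpos[of "[]"] by simp
  have qm: "quasi_multiplicative (\<bar>s\<bar> * B + B') (\<lambda>u. r u powr s * m u)" for s
    by (intro quasi_multiplicative_times quasi_multiplicative_powr r m)
  have split: "r u powr t * m u = r u powr (t - s) * (r u powr s * m u)" for u s t
    by (simp add: powr_add[symmetric] mult.assoc[symmetric])
  have exp_form: "(E * x ^ n) powr a = exp (a * ln E + a * ln x * real n)" if "E > 0" "x > 0" for E x a :: real and n
    using that by (simp add: powr_def ln_mult ln_realpow algebra_simps)
  show ?thesis
  proof (rule strictly_decreasing_zero[where p = "\<lambda>s. growth_rate (\<lambda>u. r u powr s * m u)"])
    show "ln c < 0" using decay by simp
    show "growth_rate (\<lambda>u. r u powr t * m u) \<le> growth_rate (\<lambda>u. r u powr s * m u) + (t - s) * ln c"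
      if "s < t" for s t
    proof (rule growth_rate_le[OF qm qm, where \<alpha> = "(t - s) * ln D"])
      fix u
      have "r u powr (t - s) \<le> (D * c ^ length u) powr (t - s)"
        using decay(3)[of u] rpos[of u] that by (intro powr_mono2) auto
      then show "r u powr t * m u \<le>
          exp ((t - s) * ln D + (t - s) * ln c * real (length u)) * (r u powr s * m u)"
        unfolding split[of u t s] exp_form[OF D decay(1)]
        by (intro mult_right_mono) (auto simp: less_imp_le mpos)
    qed
    show "growth_rate (\<lambda>u. r u powr s * m u) + (t - s) * ln b \<le> growth_rate (\<lambda>u. r u powr t * m u)"
      if "s < t" for s t
    proof -
      \<comment> \<open>With s and t exchanged the exponent s - t is negative, so the lower bound on
        r u becomes an upper bound on its power.\<close>
      have "growth_rate (\<lambda>u. r u powr s * m u) \<le> growth_rate (\<lambda>u. r u powr t * m u) + (s - t) * ln b"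
      proof (rule growth_rate_le[OF qm qm, where \<alpha> = "(s - t) * ln (r [])"])
        fix u
        have "r u powr (s - t) \<le> (r [] * b ^ length u) powr (s - t)"
          using b rpos[of "[]"] that by (intro powr_mono2') auto
        then show "r u powr s * m u \<le>
            exp ((s - t) * ln (r []) + (s - t) * ln b * real (length u)) * (r u powr t * m u)"
          unfolding split[of u s t] exp_form[OF rpos b(1)]
          by (intro mult_right_mono) (auto simp: less_imp_le mpos)
      qed
      then show ?thesis by (simp add: algebra_simps)
    qed
  qed (use that in blast)
qed

subsection \<open>Conformal maps\<close>

text \<open>A positive multiple of an isometry stretches all vectors equally, so the operator norm
  can be read off from a single nonzero vector.\<close>

lemma conformal_linear:
  fixes L :: "real ^ 'd \<Rightarrow> real ^ 'd"
  assumes "conformal_linear L"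
  shows conformal_linear_norm: "norm (L v) = onorm L * norm v"
    and conformal_linear_onorm_pos: "onorm L > 0"
proof -
  obtain r T where r: "r > 0" and T: "orthogonal_transformation T" and L: "L = (\<lambda>v. r *\<^sub>R T v)"
    using assms by (auto simp: conformal_linear_def)
  have lin: "linear L"
    unfolding L using T by (intro linear_compose_scale_right) (simp add: orthogonal_transformation_linear)
  have norm: "norm (L v) = r * norm v" for v
    using r T by (simp add: L orthogonal_transformation_norm)
  obtain e :: "real ^ 'd" where e: "norm e = 1" using vector_choose_size[of 1] by auto
  have "onorm L \<le> r" by (rule onorm_le) (simp add: norm)
  moreover have "r \<le> onorm L"
    using onorm[OF linear_conv_bounded_linear[THEN iffD1, OF lin], of e] norm[of e] e by simp
  ultimately have "onorm L = r" by simp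
  then show "norm (L v) = onorm L * norm v" "onorm L > 0" using norm r by simp_all
qed

lemma conformal_linear_compose:
  assumes "conformal_linear L" "conformal_linear M"
  shows "conformal_linear (L \<circ> M)"
proof -
  obtain r T where L: "r > 0" "orthogonal_transformation T" "L = (\<lambda>v. r *\<^sub>R T v)"
    using assms(1) by (auto simp: conformal_linear_def)
  obtain s S where M: "s > 0" "orthogonal_transformation S" "M = (\<lambda>v. s *\<^sub>R S v)"
    using assms(2) by (auto simp: conformal_linear_def)
  have "L \<circ> M = (\<lambda>v. (r * s) *\<^sub>R (T \<circ> S) v)"
    using L M by (auto simp: linear_cmul[OF orthogonal_transformation_linear])
  then show ?thesis
    unfolding conformal_linear_def using L M orthogonal_transformation_compose[OF L(2) M(2)]
    by (metis mult_pos_pos)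
qed

text \<open>Equality instead of submultiplicativity: the chain rule becomes an exact product formula
  for derivative norms.\<close>

lemma onorm_conformal_linear_compose:
  fixes L M :: "real ^ 'd \<Rightarrow> real ^ 'd"
  assumes "conformal_linear L" "conformal_linear M"
  shows "onorm (L \<circ> M) = onorm L * onorm M"
proof -
  obtain e :: "real ^ 'd" where e: "norm e = 1" using vector_choose_size[of 1] by auto
  show ?thesis
    using conformal_linear_norm[OF conformal_linear_compose[OF assms], of e] e
      conformal_linear_norm[OF assms(1), of "M e"] conformal_linear_norm[OF assms(2), of e]
    by simp
qed

text \<open>Contraction is given on \<open>J\<close> only, so it is tested at an interior point. By
  conformality one small vector v replaces all directions.\<close>

lemma conformal_derivative_le:
  fixes f L :: "real ^ 'd \<Rightarrow> real ^ 'd"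
  assumes deriv: "(f has_derivative L) (at x)" and conf: "conformal_linear L"
    and S: "x \<in> interior S" and lip: "\<And>y. y \<in> S \<Longrightarrow> norm (f y - f x) \<le> c * norm (y - x)"
  shows "onorm L \<le> c"
proof (rule field_le_epsilon)
  fix e :: real assume "e > 0"
  then obtain d where d: "d > 0" "\<And>y. norm (y - x) < d \<Longrightarrow> norm (f y - f x - L (y - x)) \<le> e * norm (y - x)"
    using deriv unfolding has_derivative_at_alt by blast
  obtain d' where d': "d' > 0" "ball x d' \<subseteq> S" using S mem_interior by blast
  have "0 < min d d' / 2" using d(1) d'(1) by simp
  then obtain v :: "real ^ 'd" where v: "norm v = min d d' / 2" using vector_choose_size less_imp_le by metis
  have "x + v \<in> S" using d' v d(1) by (intro subsetD[OF d'(2)]) (auto simp: dist_norm)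
  have "onorm L * norm v = norm (L v)" by (simp add: conformal_linear_norm[OF conf])
  also have "\<dots> \<le> norm (f (x + v) - f x) + norm (f (x + v) - f x - L v)"
    using norm_triangle_sub[of "L v" "f (x + v) - f x"] by (simp add: norm_minus_commute)
  also have "\<dots> \<le> c * norm v + e * norm v"
  proof (rule add_mono)
    have "norm v < d" using v d(1) d'(1) by linarith
    then show "norm (f (x + v) - f x - L v) \<le> e * norm v" using d(2)[of "x + v"] by simp
  qed (use lip[OF \<open>x + v \<in> S\<close>] in simp)
  finally have "onorm L * norm v \<le> (c + e) * norm v" by (simp add: algebra_simps)
  then show "onorm L \<le> c + e" using v d(1) d'(1) by (simp add: mult_le_cancel_right)
qed

text \<open>On the largest ball around \<open>f x\<close> inside the image, the inverse is Lipschitz with constant \<open>M\<close>; if the ball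
  were smaller than claimed, the preimages of its points would stay in a compact subset of \<open>ball x \<rho>\<close>,
  and so its boundary would still lie in the image.\<close>

lemma ball_subset_image_ball:
  fixes f :: "'a::euclidean_space \<Rightarrow> 'a"
  assumes "\<rho> > 0" "M > 0" and inj: "inj_on f (ball x \<rho>)"
    and deriv: "\<And>y. y \<in> ball x \<rho> \<Longrightarrow> (f has_derivative f' y) (at y)"
    and lower: "\<And>y v. y \<in> ball x \<rho> \<Longrightarrow> norm v \<le> M * norm (f' y v)"
  shows "ball (f x) (\<rho> / M) \<subseteq> f ` ball x \<rho>"
proof (rule ccontr)
  assume not_sub: "\<not> ball (f x) (\<rho> / M) \<subseteq> f ` ball x \<rho>"
  let ?S = "f ` ball x \<rho>" and ?g = "inv_into (ball x \<rho>) f"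
  obtain z where z: "z \<in> ball (f x) (\<rho> / M)" "z \<in> - ?S" using not_sub by blast
  have cont: "continuous_on (ball x \<rho>) f"
    using deriv by (meson continuous_at_imp_continuous_on has_derivative_continuous)
  have "open ?S" using cont inj by (intro invariance_of_domain) auto
  then obtain z' where z': "z' \<in> - ?S" "\<And>y. y \<in> - ?S \<Longrightarrow> dist (f x) z' \<le> dist (f x) y"
    using distance_attains_inf[of "- ?S" "f x"] z(2) by (auto simp: closed_Compl)
  define s where "s = dist (f x) z'"
  have "s < \<rho> / M" using z'(2)[OF z(2)] z(1) by (simp add: s_def)
  then have s: "M * s < \<rho>" using \<open>M > 0\<close> by (simp add: field_simps)
  have "z' \<noteq> f x" using z' \<open>\<rho> > 0\<close> by auto
  then have "s > 0" by (simp add: s_def)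
  have ball: "ball (f x) s \<subseteq> ?S" using z'(2) by (force simp: s_def)
  have gf: "?g (f y) = y" if "y \<in> ball x \<rho>" for y using inj that by (rule inv_into_f_f)
  have dg: "\<exists>g'. (?g has_derivative g') (at w) \<and> onorm g' \<le> M" if "w \<in> ball (f x) s" for w
  proof -
    obtain y where y: "y \<in> ball x \<rho>" "w = f y" using ball \<open>w \<in> ball (f x) s\<close> by blast
    have lin: "linear (f' y)" using deriv[OF y(1)] has_derivative_linear by blast
    have "inj (f' y)"
    proof (rule linear_injective_0[OF lin, THEN iffD2], intro allI impI)
      fix v assume "f' y v = 0"
      then show "v = 0" using lower[OF y(1), of v] by simp
    qed
    then obtain g' where g': "linear g'" "\<And>v. g' (f' y v) = v" "\<And>v. f' y (g' v) = v"
      using linear_injective_isomorphism[OF lin] by blast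
    have "(?g has_derivative g') (at (f y))"
      using has_derivative_inverse_strong[of "ball x \<rho>" y f ?g "f' y" g'] y cont gf deriv g'(3)
      by (simp add: fun_eq_iff)
    moreover have "onorm g' \<le> M" by (rule onorm_le) (use lower[OF y(1)] g'(3) in metis)
    ultimately show ?thesis using y(2) by blast
  qed
  then obtain g' where g': "\<And>w. w \<in> ball (f x) s \<Longrightarrow> (?g has_derivative g' w) (at w)"
    "\<And>w. w \<in> ball (f x) s \<Longrightarrow> onorm (g' w) \<le> M" by metis
  have "ball (f x) s \<subseteq> f ` cball x (M * s)"
  proof
    fix w assume w: "w \<in> ball (f x) s"
    have "norm (?g w - ?g (f x)) \<le> M * norm (w - f x)"
      using g' w \<open>s > 0\<close>
      by (intro differentiable_bound[of "ball (f x) s" ?g g']) (auto intro: has_derivative_at_withinI)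
    also have "\<dots> \<le> M * s" using w \<open>M > 0\<close> by (simp add: dist_norm norm_minus_commute)
    finally have "?g w \<in> cball x (M * s)"
      using gf[of x] \<open>\<rho> > 0\<close> by (simp add: dist_norm norm_minus_commute)
    moreover have "f (?g w) = w" using ball w by (meson f_inv_into_f subsetD)
    ultimately show "w \<in> f ` cball x (M * s)" by force
  qed
  moreover have sub: "cball x (M * s) \<subseteq> ball x \<rho>" using s by auto
  moreover have "compact (f ` cball x (M * s))"
    using continuous_on_subset[OF cont sub] by (intro compact_continuous_image) auto
  ultimately have "closure (ball (f x) s) \<subseteq> ?S"
    by (meson closure_minimal compact_imp_closed image_mono subset_trans)
  moreover have "z' \<in> closure (ball (f x) s)" using \<open>s > 0\<close> by (simp add: s_def)
  ultimately show False using z'(1) by blast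
qed

text \<open>Volume comparison. When r and R are both proportional to \<delta>, the bound is
  independent of \<delta>.\<close>

lemma card_disjoint_balls_le:
  fixes z :: "'a \<Rightarrow> 'b::euclidean_space"
  assumes "finite A" "disjoint_family_on (\<lambda>a. ball (z a) r) A" "r > 0" "R \<ge> 0"
    and sub: "\<And>a. a \<in> A \<Longrightarrow> ball (z a) r \<subseteq> cball c R"
  shows "real (card A) \<le> (R / r) ^ DIM('b)"
proof -
  let ?V = "unit_ball_vol (real DIM('b))"
  have fin: "ball (z a) r \<in> fmeasurable lborel" "cball c R \<in> fmeasurable lborel" for a
    using emeasure_lborel_ball_finite emeasure_lborel_cball_finite by (auto simp: fmeasurable_def)
  have "real (card A) * (?V * r ^ DIM('b)) = (\<Sum>a\<in>A. measure lborel (ball (z a) r))"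
    using assms(3) by (simp add: content_ball)
  also have "\<dots> = measure lborel (\<Union>a\<in>A. ball (z a) r)"
    using assms(1,2) fin(1) by (intro measure_finite_Union[symmetric]) (auto simp: fmeasurable_def image_subset_iff less_top)
  also have "\<dots> \<le> measure lborel (cball c R)"
    using assms sub fin by (intro measure_mono_fmeasurable) auto
  also have "\<dots> = ?V * R ^ DIM('b)" using assms(4) by (simp add: content_cball)
  finally have "?V * (real (card A) * r ^ DIM('b)) \<le> ?V * R ^ DIM('b)" by (simp add: mult_ac)
  then have "real (card A) * r ^ DIM('b) \<le> R ^ DIM('b)" by simp
  then show ?thesis using assms(3) by (simp add: power_divide field_simps)
qed

subsection \<open>Geometry of the cylinder sets\<close>

lemma word_map_append: "word_map \<phi> (u @ v) = word_map \<phi> u \<circ> word_map \<phi> v"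
  by (induction u) auto

text \<open>The supremum occurring in \<open>pressure\<close>; up to constants it is the size of
  \<open>Jw u\<close>.\<close>

definition sup_deriv_norm :: "(real ^ 'd) set \<Rightarrow> ('i \<Rightarrow> real ^ 'd \<Rightarrow> real ^ 'd) \<Rightarrow> 'i list \<Rightarrow> real" where
  "sup_deriv_norm J \<phi> u = (SUP x\<in>J. deriv_norm \<phi> u x)"

context acifs
begin

lemma word_map_in_V: "x \<in> V \<Longrightarrow> word_map \<phi> u x \<in> V"
  using conformal by (induction u) (auto simp: C1_conformal_diffeo_into_def)

lemma word_map_in_J: "x \<in> J \<Longrightarrow> word_map \<phi> u x \<in> J"
  using maps_J by (induction u) auto

lemma word_map_inj: "inj_on (word_map \<phi> u) V"
proof (induction u)
  case (Cons i u)
  have "inj_on (\<phi> i) V" using conformal by (auto simp: C1_conformal_diffeo_into_def)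
  then have "inj_on (\<phi> i) (word_map \<phi> u ` V)"
    by (rule inj_on_subset) (auto intro: word_map_in_V)
  with Cons show ?case unfolding word_map.simps by (rule comp_inj_on)
qed simp

lemma word_map_deriv:
  assumes "x \<in> V"
  shows word_map_has_derivative:
      "(word_map \<phi> u has_derivative frechet_derivative (word_map \<phi> u) (at x)) (at x)"
    and word_map_conformal: "conformal_linear (frechet_derivative (word_map \<phi> u) (at x))"
proof -
  have "word_map \<phi> u differentiable (at x) \<and> conformal_linear (frechet_derivative (word_map \<phi> u) (at x))"
  proof (induction u)
    case Nil
    have "conformal_linear (id :: real ^ 'd \<Rightarrow> real ^ 'd)"
      unfolding conformal_linear_def
      by (rule exI[of _ 1]) (auto intro!: exI[of _ id] orthogonal_transformation_id simp: id_def)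
    then show ?case by (simp add: frechet_derivative_id id_def)
  next
    case (Cons i u)
    let ?y = "word_map \<phi> u x"
    have y: "?y \<in> V" using assms by (rule word_map_in_V)
    have i: "\<phi> i differentiable (at ?y)" "conformal_linear (frechet_derivative (\<phi> i) (at ?y))"
      using conformal[of i] y by (auto simp: C1_conformal_diffeo_into_def C1_on_def differentiable_def)
    have "frechet_derivative (\<phi> i \<circ> word_map \<phi> u) (at x) =
        frechet_derivative (\<phi> i) (at ?y) \<circ> frechet_derivative (word_map \<phi> u) (at x)"
      using Cons i by (simp add: frechet_derivative_compose)
    then show ?case
      using Cons i differentiable_chain_at[of "word_map \<phi> u" x "\<phi> i"] unfolding word_map.simps
      by (metis conformal_linear_compose)
  qed
  then show "(word_map \<phi> u has_derivative frechet_derivative (word_map \<phi> u) (at x)) (at x)"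
    "conformal_linear (frechet_derivative (word_map \<phi> u) (at x))"
    by (simp_all flip: frechet_derivative_works)
qed

lemma deriv_norm_pos: "x \<in> V \<Longrightarrow> deriv_norm \<phi> u x > 0"
  unfolding deriv_norm_def by (intro conformal_linear_onorm_pos word_map_conformal)

lemma deriv_norm_append:
  assumes "x \<in> V"
  shows "deriv_norm \<phi> (u @ v) x = deriv_norm \<phi> u (word_map \<phi> v x) * deriv_norm \<phi> v x"
proof -
  have y: "word_map \<phi> v x \<in> V" using assms by (rule word_map_in_V)
  have "frechet_derivative (word_map \<phi> u \<circ> word_map \<phi> v) (at x) =
      frechet_derivative (word_map \<phi> u) (at (word_map \<phi> v x)) \<circ> frechet_derivative (word_map \<phi> v) (at x)"
    using word_map_has_derivative[OF assms, of v] word_map_has_derivative[OF y, of u]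
    by (intro frechet_derivative_compose) (auto simp: differentiable_def)
  then show ?thesis
    unfolding deriv_norm_def word_map_append
    by (simp add: onorm_conformal_linear_compose word_map_conformal assms y)
qed

abbreviation ratio :: "'i list \<Rightarrow> real" where
  "ratio \<equiv> sup_deriv_norm J \<phi>"

lemma J_nonempty: "J \<noteq> {}"
  using interior_J interior_subset by blast

lemma ratio_distortion:
  obtains C where "C \<ge> 1" "\<And>u x. x \<in> V \<Longrightarrow> deriv_norm \<phi> u x \<le> C * ratio u"
    "\<And>u x. x \<in> V \<Longrightarrow> ratio u \<le> C * deriv_norm \<phi> u x"
proof -
  obtain C where C: "C \<ge> 1" "\<And>u x y. x \<in> V \<Longrightarrow> y \<in> V \<Longrightarrow> deriv_norm \<phi> u x \<le> C * deriv_norm \<phi> u y"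
    using bounded_distortion by blast
  obtain x0 where x0: "x0 \<in> J" using J_nonempty by blast
  have JV: "x \<in> V" if "x \<in> J" for x using that J_subset_V by blast
  \<comment> \<open>Boundedness comes first, since a \<open>SUP\<close> over an unbounded set of
    reals would not dominate its members.\<close>
  have bdd: "bdd_above (deriv_norm \<phi> u ` J)" for u
    by (rule bdd_aboveI[of _ "C * deriv_norm \<phi> u x0"]) (use C(2) JV x0 in auto)
  show ?thesis
  proof (rule that)
    show "C \<ge> 1" by (rule C(1))
    fix u x assume x: "x \<in> V"
    have "deriv_norm \<phi> u x \<le> C * deriv_norm \<phi> u x0" using C(2) x JV x0 by blast
    also have "\<dots> \<le> C * ratio u"
      unfolding sup_deriv_norm_def using C(1) by (intro mult_left_mono cSUP_upper bdd x0) auto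
    finally show "deriv_norm \<phi> u x \<le> C * ratio u" .
    show "ratio u \<le> C * deriv_norm \<phi> u x"
      unfolding sup_deriv_norm_def using x C(2) JV J_nonempty by (intro cSUP_least) auto
  qed
qed

lemma ratio_pos: "ratio u > 0"
proof -
  obtain C where C: "C \<ge> 1" "\<And>u x. x \<in> V \<Longrightarrow> deriv_norm \<phi> u x \<le> C * ratio u"
    using ratio_distortion by metis
  obtain x0 where x0: "x0 \<in> V" using J_nonempty J_subset_V by blast
  have "0 < C * ratio u" using C(2)[OF x0, of u] deriv_norm_pos[OF x0, of u] by linarith
  then show ?thesis using C(1) by (simp add: zero_less_mult_iff)
qed

lemma ratio_Nil: "ratio [] = 1"
proof -
  have "deriv_norm \<phi> [] x = 1" for x
    by (simp add: deriv_norm_def id_def onorm_id)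
  then show ?thesis using J_nonempty by (simp add: sup_deriv_norm_def)
qed

lemma quasi_multiplicative_ratio: "\<exists>B. quasi_multiplicative B ratio"
proof -
  obtain C where C: "C \<ge> 1" "\<And>u x. x \<in> V \<Longrightarrow> deriv_norm \<phi> u x \<le> C * ratio u"
    "\<And>u x. x \<in> V \<Longrightarrow> ratio u \<le> C * deriv_norm \<phi> u x"
    using ratio_distortion by metis
  obtain x0 where x0: "x0 \<in> V" using J_nonempty J_subset_V by blast
  have pos: "0 \<le> deriv_norm \<phi> u x" if "x \<in> V" for u x using deriv_norm_pos[OF that] by (simp add: less_imp_le)
  have r0: "0 \<le> ratio u" for u using ratio_pos[of u] by simp
  \<comment> \<open>Passing between a supremum and a value at a point costs a factor C, and this
    happens three times: for u @ v, for u and for v.\<close>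
  have "quasi_multiplicative (ln (C ^ 3)) ratio"
  proof (rule quasi_multiplicativeI)
    fix u v
    have y: "word_map \<phi> v x0 \<in> V" using x0 by (rule word_map_in_V)
    have "ratio (u @ v) \<le> C * (deriv_norm \<phi> u (word_map \<phi> v x0) * deriv_norm \<phi> v x0)"
      using C(3)[OF x0, of "u @ v"] by (simp add: deriv_norm_append x0)
    also have "\<dots> \<le> C * ((C * ratio u) * (C * ratio v))"
      using C x0 y pos r0 by (intro mult_left_mono mult_mono) auto
    finally show "ratio (u @ v) \<le> C ^ 3 * (ratio u * ratio v)"
      by (simp add: power3_eq_cube mult_ac)
    have "ratio u * ratio v \<le> (C * deriv_norm \<phi> u (word_map \<phi> v x0)) * (C * deriv_norm \<phi> v x0)"
      using C x0 y pos r0 by (intro mult_mono) auto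
    also have "\<dots> = C\<^sup>2 * deriv_norm \<phi> (u @ v) x0"
      by (simp add: deriv_norm_append x0 power2_eq_square mult_ac)
    also have "\<dots> \<le> C\<^sup>2 * (C * ratio (u @ v))"
      using C x0 by (intro mult_left_mono) auto
    finally show "ratio u * ratio v \<le> C ^ 3 * ratio (u @ v)"
      by (simp add: power3_eq_cube power2_eq_square mult_ac)
  qed (use C ratio_pos in auto)
  then show ?thesis by blast
qed

text \<open>Iterated contraction bounds the derivative at an interior point of \<open>J\<close>, and
  distortion carries the bound to the supremum; D is the distortion constant.\<close>

lemma ratio_exponential_decay:
  obtains c D where "0 < c" "c < 1" "\<And>u. ratio u \<le> D * c ^ length u"
proof -
  obtain C where C: "C \<ge> 1" "\<And>u x. x \<in> V \<Longrightarrow> ratio u \<le> C * deriv_norm \<phi> u x"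
    using ratio_distortion by metis
  obtain c where c: "0 < c" "c < 1" "\<And>i x y. x \<in> J \<Longrightarrow> y \<in> J \<Longrightarrow> norm (\<phi> i x - \<phi> i y) \<le> c * norm (x - y)"
    using contraction by blast
  have lip: "norm (word_map \<phi> u x - word_map \<phi> u y) \<le> c ^ length u * norm (x - y)"
    if "x \<in> J" "y \<in> J" for u x y
  proof (induction u)
    case (Cons i u)
    have "norm (word_map \<phi> (i # u) x - word_map \<phi> (i # u) y) \<le> c * norm (word_map \<phi> u x - word_map \<phi> u y)"
      using c(3) word_map_in_J that by simp
    also have "\<dots> \<le> c * (c ^ length u * norm (x - y))" using Cons c by simp
    finally show ?case by (simp add: mult_ac)
  qed simp
  obtain x0 where x0: "x0 \<in> interior J" using interior_J by blast
  then have x0': "x0 \<in> J" "x0 \<in> V" using interior_subset J_subset_V by blast+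
  have "ratio u \<le> C * c ^ length u" for u
  proof -
    have "deriv_norm \<phi> u x0 \<le> c ^ length u"
      unfolding deriv_norm_def using x0 x0' lip
      by (intro conformal_derivative_le[of "word_map \<phi> u" _ x0 J] word_map_deriv) auto
    then show ?thesis using C(2)[OF x0'(2), of u] C(1)
      by (meson mult_left_mono order_trans zero_le_one)
  qed
  with c(1,2) show ?thesis by (rule that)
qed

text \<open>\<open>J\<close> need not be connected, so the derivative bound is propagated along chains of balls in \<open>V\<close>.\<close>

lemma word_map_diam:
  obtains L where "L > 0"
    "\<And>u x y. x \<in> J \<Longrightarrow> y \<in> J \<Longrightarrow> norm (word_map \<phi> u x - word_map \<phi> u y) \<le> L * ratio u"
proof -
  obtain C where C: "C \<ge> 1" "\<And>u x. x \<in> V \<Longrightarrow> deriv_norm \<phi> u x \<le> C * ratio u"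
    using ratio_distortion by metis
  have local: "norm (word_map \<phi> u y - word_map \<phi> u z) \<le> C * e * 2 * ratio u"
    if "ball x e \<subseteq> V" "y \<in> ball x e" "z \<in> ball x e" for x e y z u
  proof -
    have "norm (word_map \<phi> u y - word_map \<phi> u z) \<le> (C * ratio u) * norm (y - z)"
    proof (rule differentiable_bound[of "ball x e" _ "\<lambda>x. frechet_derivative (word_map \<phi> u) (at x)"])
      fix w assume "w \<in> ball x e"
      then have w: "w \<in> V" using that(1) by blast
      show "(word_map \<phi> u has_derivative frechet_derivative (word_map \<phi> u) (at w)) (at w within ball x e)"
        using word_map_has_derivative[OF w] by (rule has_derivative_at_withinI)
      show "onorm (frechet_derivative (word_map \<phi> u) (at w)) \<le> C * ratio u"
        using C(2)[OF w, of u] by (simp add: deriv_norm_def)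
    qed (use that in auto)
    also have "\<dots> \<le> (C * ratio u) * (2 * e)"
    proof (rule mult_left_mono)
      show "norm (y - z) \<le> 2 * e"
        using that(2,3) dist_triangle3[of y z x] by (simp add: dist_norm)
      show "0 \<le> C * ratio u" using C(1) ratio_pos[of u] by simp
    qed
    finally show ?thesis by (simp add: mult_ac)
  qed
  obtain x0 where x0: "x0 \<in> J" using J_nonempty by blast
  have ex_ball: "\<exists>e>0. ball x e \<subseteq> V" if "x \<in> V" for x
    using open_V that by (simp add: open_contains_ball)
  \<comment> \<open>K may depend on x but is chosen before u: the constant is common to all
    words.\<close>
  have K: "\<exists>K. \<forall>u. norm (word_map \<phi> u x0 - word_map \<phi> u x) \<le> K * ratio u" if "x \<in> V" for x
  proof (rule connected_induction_simple[OF connected_V _ that,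
        where P = "\<lambda>x. \<exists>K. \<forall>u. norm (word_map \<phi> u x0 - word_map \<phi> u x) \<le> K * ratio u"])
    show "x0 \<in> V" using x0 J_subset_V by blast
    show "\<exists>K. \<forall>u. norm (word_map \<phi> u x0 - word_map \<phi> u x0) \<le> K * ratio u"
      by (rule exI[of _ 0]) simp
    fix a assume "a \<in> V"
    then obtain e where e: "e > 0" "ball a e \<subseteq> V" using ex_ball by blast
    have "\<exists>K. \<forall>u. norm (word_map \<phi> u x0 - word_map \<phi> u z) \<le> K * ratio u"
      if "y \<in> ball a e" "z \<in> ball a e" and K: "\<And>u. norm (word_map \<phi> u x0 - word_map \<phi> u y) \<le> K * ratio u"
      for y z K
    proof (intro exI[of _ "K + C * e * 2"] allI)
      fix u
      show "norm (word_map \<phi> u x0 - word_map \<phi> u z) \<le> (K + C * e * 2) * ratio u"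
        using K[of u] local[OF e(2) that(1,2), of u]
          norm_diff_triangle_le[of "word_map \<phi> u x0" "word_map \<phi> u y"] by (simp add: distrib_right)
    qed
    then have step: "\<forall>x\<in>ball a e. \<forall>y\<in>ball a e.
        (\<exists>K. \<forall>u. norm (word_map \<phi> u x0 - word_map \<phi> u x) \<le> K * ratio u) \<longrightarrow>
        (\<exists>K. \<forall>u. norm (word_map \<phi> u x0 - word_map \<phi> u y) \<le> K * ratio u)" by blast
    show "\<exists>T. openin (top_of_set V) T \<and> a \<in> T \<and> (\<forall>x\<in>T. \<forall>y\<in>T.
        (\<exists>K. \<forall>u. norm (word_map \<phi> u x0 - word_map \<phi> u x) \<le> K * ratio u) \<longrightarrow>
        (\<exists>K. \<forall>u. norm (word_map \<phi> u x0 - word_map \<phi> u y) \<le> K * ratio u))"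
      by (rule exI[of _ "ball a e"], intro conjI step) (use e open_V in \<open>auto simp: openin_open_eq\<close>)
  qed
  have "\<exists>e K. e > 0 \<and> (\<forall>y\<in>ball x e. \<forall>u. norm (word_map \<phi> u x0 - word_map \<phi> u y) \<le> K * ratio u)"
    if "x \<in> J" for x
  proof -
    have "x \<in> V" using that J_subset_V by blast
    then obtain e where e: "e > 0" "ball x e \<subseteq> V" using ex_ball by blast
    obtain K' where K': "\<And>u. norm (word_map \<phi> u x0 - word_map \<phi> u x) \<le> K' * ratio u"
      using K[OF \<open>x \<in> V\<close>] by blast
    have "norm (word_map \<phi> u x0 - word_map \<phi> u y) \<le> (K' + C * e * 2) * ratio u"
      if "y \<in> ball x e" for y u
      using K'[of u] local[OF e(2) _ that, of x u] e(1)
          norm_diff_triangle_le[of "word_map \<phi> u x0" "word_map \<phi> u x"] by (simp add: distrib_right)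
    then show ?thesis using e(1) by blast
  qed
  then obtain e K' where eK: "\<And>x. x \<in> J \<Longrightarrow> e x > 0"
    "\<And>x y u. x \<in> J \<Longrightarrow> y \<in> ball x (e x) \<Longrightarrow> norm (word_map \<phi> u x0 - word_map \<phi> u y) \<le> K' x * ratio u"
    by metis
  \<comment> \<open>Compactness of \<open>J\<close> reduces the constants depending on x to finitely
    many.\<close>
  obtain F where F: "F \<subseteq> J" "finite F" "J \<subseteq> (\<Union>x\<in>F. ball x (e x))"
    using compactE_image[OF compact_J, of J "\<lambda>x. ball x (e x)"] eK(1) by force
  define L where "L = (\<Sum>x\<in>F. \<bar>K' x\<bar>)"
  have L: "norm (word_map \<phi> u x0 - word_map \<phi> u y) \<le> L * ratio u" if "y \<in> J" for u y
  proof -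
    obtain x where x: "x \<in> F" "y \<in> ball x (e x)" using F(3) \<open>y \<in> J\<close> by blast
    have "K' x \<le> L" unfolding L_def using member_le_sum[of x F "\<lambda>x. \<bar>K' x\<bar>"] x(1) F(2) by fastforce
    then show ?thesis using eK(2)[of x y u] x F(1) ratio_pos[of u]
      by (meson less_imp_le mult_right_mono order_trans subsetD)
  qed
  have "L \<ge> 0" by (simp add: L_def sum_nonneg)
  show ?thesis
  \<comment> \<open>Both points are compared with x0, hence the factor 2; the summand 1 makes the
    constant positive.\<close>
  proof (rule that[of "2 * L + 1"])
    fix u x y assume "x \<in> J" "y \<in> J"
    then show "norm (word_map \<phi> u x - word_map \<phi> u y) \<le> (2 * L + 1) * ratio u"
      using L[of x u] L[of y u] ratio_pos[of u]
        norm_triangle_ineq4[of "word_map \<phi> u x0 - word_map \<phi> u y" "word_map \<phi> u x0 - word_map \<phi> u x"]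
      by (simp add: algebra_simps)
  qed (use \<open>L \<ge> 0\<close> in simp)
qed

text \<open>On a ball of radius \<rho> in \<open>J\<close>, distortion bounds the derivative norm
  from below by ratio u / C. The inverse thus has Lipschitz constant C / ratio u, and the image
  contains a ball of radius \<rho> / C * ratio u.\<close>

lemma word_map_contains_ball:
  obtains \<kappa> where "\<kappa> > 0" "\<And>u. \<exists>z. ball z (\<kappa> * ratio u) \<subseteq> word_map \<phi> u ` J"
proof -
  obtain C where C: "C \<ge> 1" "\<And>u x. x \<in> V \<Longrightarrow> ratio u \<le> C * deriv_norm \<phi> u x"
    using ratio_distortion by metis
  obtain x0 \<rho> where \<rho>: "\<rho> > 0" "ball x0 \<rho> \<subseteq> J" using interior_J mem_interior by blast
  have JV: "y \<in> V" if "y \<in> ball x0 \<rho>" for y using that \<rho>(2) J_subset_V by blast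
  have "ball (word_map \<phi> u x0) (\<rho> / C * ratio u) \<subseteq> word_map \<phi> u ` J" for u
  proof -
    have "ball (word_map \<phi> u x0) (\<rho> / (C / ratio u)) \<subseteq> word_map \<phi> u ` ball x0 \<rho>"
    proof (rule ball_subset_image_ball)
      show "inj_on (word_map \<phi> u) (ball x0 \<rho>)" using word_map_inj by (rule inj_on_subset) (use JV in blast)
      fix y and v :: "real ^ 'd" assume y: "y \<in> ball x0 \<rho>"
      show "(word_map \<phi> u has_derivative frechet_derivative (word_map \<phi> u) (at y)) (at y)"
        by (intro word_map_has_derivative JV y)
      have "ratio u * norm v \<le> C * deriv_norm \<phi> u y * norm v"
        using C(2) JV y by (intro mult_right_mono) auto
      also have "\<dots> = C * norm (frechet_derivative (word_map \<phi> u) (at y) v)"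
        using conformal_linear_norm[OF word_map_conformal[OF JV[OF y]], of u v] by (simp add: deriv_norm_def)
      finally show "norm v \<le> C / ratio u * norm (frechet_derivative (word_map \<phi> u) (at y) v)"
        using ratio_pos[of u] by (simp add: field_simps)
    qed (use \<rho> C ratio_pos[of u] in auto)
    then show ?thesis using \<rho>(2) by auto
  qed
  then show ?thesis using that[of "\<rho> / C"] \<rho>(1) C(1) by (metis divide_pos_pos zero_less_one less_le_trans)
qed

lemma Jw_append: "Jw (u @ v) \<subseteq> Jw u"
proof (induction v rule: rev_induct)
  case (snoc i v)
  then show ?case using nested[of "u @ v" i] by simp
qed simp

lemma Jw_nonempty: "Jw u \<noteq> {}"
  using translate[of u] J_nonempty by auto

lemma Jw_compact: "compact (Jw u)"
  using closed_Jw Jw_subset compact_J by (metis compact_Int_closed inf.absorb_iff2)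

lemma Jw_diam:
  obtains L where "L > 0" "\<And>u x y. x \<in> Jw u \<Longrightarrow> y \<in> Jw u \<Longrightarrow> norm (x - y) \<le> L * ratio u"
proof -
  obtain L where L: "L > 0"
    "\<And>u x y. x \<in> J \<Longrightarrow> y \<in> J \<Longrightarrow> norm (word_map \<phi> u x - word_map \<phi> u y) \<le> L * ratio u"
    using word_map_diam by metis
  have "norm (x - y) \<le> L * ratio u" if "x \<in> Jw u" "y \<in> Jw u" for u x y
    using translate[of u] L(2)[of _ _ u] that by force
  with L(1) show ?thesis by (rule that)
qed

text \<open>A translation moves the ball but keeps its radius, so the arbitrary vectors \<omega> do
  no harm.\<close>

lemma Jw_contains_ball:
  obtains \<kappa> where "\<kappa> > 0" "\<And>u. \<exists>z. ball z (\<kappa> * ratio u) \<subseteq> interior (Jw u)"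
proof -
  obtain \<kappa> where \<kappa>: "\<kappa> > 0" "\<And>u. \<exists>z. ball z (\<kappa> * ratio u) \<subseteq> word_map \<phi> u ` J"
    using word_map_contains_ball by metis
  have "\<exists>z. ball z (\<kappa> * ratio u) \<subseteq> interior (Jw u)" for u
  proof -
    obtain z where z: "ball z (\<kappa> * ratio u) \<subseteq> word_map \<phi> u ` J" using \<kappa>(2) by blast
    obtain \<omega> where \<omega>: "Jw u = (\<lambda>x. word_map \<phi> u x + \<omega>) ` J" using translate by blast
    have "ball (z + \<omega>) (\<kappa> * ratio u) \<subseteq> Jw u"
    proof
      fix y assume "y \<in> ball (z + \<omega>) (\<kappa> * ratio u)"
      then have "y - \<omega> \<in> ball z (\<kappa> * ratio u)" by (simp add: dist_norm algebra_simps)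
      then obtain x where "x \<in> J" "y - \<omega> = word_map \<phi> u x" using z by blast
      then show "y \<in> Jw u" unfolding \<omega> by (intro image_eqI[of _ _ x]) (auto simp: algebra_simps)
    qed
    then show ?thesis by (meson interior_maximal open_ball)
  qed
  with \<kappa>(1) show ?thesis by (rule that)
qed

text \<open>The open set condition applies where the two words first disagree, and nesting passes it
  on to their continuations.\<close>

lemma interior_Jw_disjoint:
  assumes "open_set_condition Jw" "u \<parallel> v"
  shows "interior (Jw u) \<inter> interior (Jw v) = {}"
proof -
  obtain w i u' j v' where "i \<noteq> j" "u = (w @ [i]) @ u'" "v = (w @ [j]) @ v'"
    using parallel_decomp[OF assms(2)] by auto
  then show ?thesis
    using assms(1) interior_mono[OF Jw_append[of "w @ [i]" u']] interior_mono[OF Jw_append[of "w @ [j]" v']]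
    unfolding open_set_condition_def by blast
qed

end

section \<open>Stopping words: lower bound on the weight and incomparability\<close>

lemma quasi_multiplicative_stopping_lower:
  fixes r :: "'i::finite list \<Rightarrow> real"
  assumes r: "quasi_multiplicative B r"
  obtains b where "0 < b" "b \<le> 1" "\<And>\<delta> u. \<delta> < r [] \<Longrightarrow> u \<in> stopping_words r \<delta> \<Longrightarrow> b * \<delta> \<le> r u"
proof -
  have pos: "r u > 0" for u using r by (rule quasi_multiplicative_pos)
  \<comment> \<open>The parent of a stopping word still exceeds \<delta>, and one more letter costs
    at most the second argument of the minimum. The first argument ensures ln b \<le> 0 for the
    later comparison of powers.\<close>
  define b where "b = min 1 (exp (-B) * Min (range (\<lambda>i. r [i])))"
  have "b > 0" using pos by (simp add: b_def)
  have "b * \<delta> \<le> r u" if "\<delta> < r []" "u \<in> stopping_words r \<delta>" for \<delta> u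
  proof (cases "\<delta> > 0")
    case True
    \<comment> \<open>As \<delta> < r [], the empty word does not stop, so there is a last letter to
      remove.\<close>
    have "u \<noteq> []" using that by (auto simp: stopping_words_def)
    then obtain w i where u: "u = w @ [i]" by (cases u rule: rev_cases) auto
    have "\<delta> < r w" using that(2) by (auto simp: stopping_words_def u dest!: spec[of _ "length w"])
    have "b * \<delta> \<le> (exp (-B) * r [i]) * r w"
    proof (intro mult_mono)
      have "b \<le> exp (-B) * Min (range (\<lambda>i. r [i]))" by (simp add: b_def)
      also have "\<dots> \<le> exp (-B) * r [i]" by simp
      finally show "b \<le> exp (-B) * r [i]" .
    qed (use True \<open>\<delta> < r w\<close> pos[of "[i]"] in auto)
    also have "\<dots> \<le> r u" using quasi_multiplicative_append(2)[OF r, of w "[i]"] by (simp add: u mult_ac)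
    finally show ?thesis .
  next
    case False
    then show ?thesis using \<open>b > 0\<close> pos[of u] by (smt (verit) mult_nonneg_nonpos)
  qed
  with \<open>b > 0\<close> show ?thesis by (intro that[of b]) (auto simp: b_def)
qed

text \<open>If one were a proper prefix of the other, its weight would have to be at most \<delta>
  and also exceed \<delta>.\<close>

lemma stopping_words_parallel:
  assumes "u \<in> stopping_words r \<delta>" "v \<in> stopping_words r \<delta>" "u \<noteq> v"
  shows "u \<parallel> v"
proof -
  have "\<not> prefix u v" if "u \<in> stopping_words r \<delta>" "v \<in> stopping_words r \<delta>" "u \<noteq> v" for u v
  proof
    assume "prefix u v"
    then have "length u < length v" "take (length u) v = u"
      using that(3) by (auto simp: prefix_def)
    then have "\<delta> < r u" using that(2) by (force simp: stopping_words_def)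
    then show False using that(1) by (simp add: stopping_words_def)
  qed
  then show ?thesis using assms by blast
qed

subsection \<open>Gibbs measures on the word space\<close>

lemma prefix_of_add: "prefix_of u (k + l) = prefix_of u k @ prefix_of ((shift ^^ k) u) l"
proof -
  have "(shift ^^ k) u = (\<lambda>n. u (k + n))"
    by (induction k) (auto simp: shift_def)
  then show ?thesis
    by (auto simp: prefix_of_def list_eq_iff_nth_eq nth_append)
qed

lemma length_prefix_of [simp]: "length (prefix_of u n) = n"
  by (simp add: prefix_of_def)

lemma take_prefix_of: "k \<le> n \<Longrightarrow> take k (prefix_of u n) = prefix_of u k"
  by (simp add: prefix_of_def take_map)

lemma ex_prefix_of: "\<exists>u. prefix_of u (length w) = w"
  \<comment> \<open>Beyond \<open>length w\<close> the witness has unspecified letters, which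
    \<open>prefix_of\<close> does not read here.\<close>
  by (rule exI[of _ "\<lambda>n. w ! n"]) (simp add: prefix_of_def map_nth)

lemma cylinder_eqI: "v \<in> cylinder (prefix_of u n) \<longleftrightarrow> prefix_of v n = prefix_of u n"
  by (simp add: cylinder_def)

lemma openin_word_topologyI:
  assumes "\<And>u. u \<in> U \<Longrightarrow> \<exists>n. cylinder (prefix_of u n) \<subseteq> U"
  shows "openin word_topology U"
proof -
  interpret W: Metric_space "UNIV :: (nat \<Rightarrow> 'a) set" word_dist by (rule Metric_space_word_dist)
  have "\<exists>r>0. W.mball u r \<subseteq> U" if "u \<in> U" for u
  proof -
    obtain n where n: "cylinder (prefix_of u n) \<subseteq> U" using assms \<open>u \<in> U\<close> by blast
    have "W.mball u ((1/2) ^ n) \<subseteq> cylinder (prefix_of u n)"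
    proof
      fix v assume "v \<in> W.mball u ((1/2) ^ n)"
      then have "word_dist u v \<le> (1/2) ^ n" by simp
      then show "v \<in> cylinder (prefix_of u n)"
        unfolding word_dist_le_iff by (simp add: cylinder_def prefix_of_def)
    qed
    with n show ?thesis by (intro exI[of _ "(1/2) ^ n"]) auto
  qed
  then show ?thesis unfolding word_topology_def W.openin_mtopology by simp
qed

lemma cylinder_in_sets: "cylinder w \<in> sets word_borel"
proof -
  have "openin word_topology (cylinder w)"
    by (rule openin_word_topologyI) (auto simp: cylinder_def intro!: exI[of _ "length w"])
  then show ?thesis by (auto simp: word_borel_def sets_measure_of_conv)
qed

lemma space_word_borel: "space word_borel = UNIV"
  by (simp add: word_borel_def space_measure_of_conv)

text \<open>The Birkhoff sum of f over k + l steps is exactly the sum over k steps at u plus the sum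
  over l steps at the k-fold shift of u. So only the Gibbs constant enters, once for each of three
  cylinders, which gives 3 * (- ln a).\<close>

lemma gibbs_measure_quasi_multiplicative:
  assumes "gibbs_measure \<mu>"
  shows "\<exists>B. quasi_multiplicative B (\<lambda>u. measure \<mu> (cylinder u))"
proof -
  obtain f P a where a: "a > 0" and
    gibbs: "\<And>u k. let r = measure \<mu> (cylinder (prefix_of u k)) / exp (- real k * P + (\<Sum>j<k. f ((shift ^^ j) u)))
       in a \<le> r \<and> r \<le> 1 / a"
    using assms unfolding gibbs_measure_def by blast
  let ?m = "\<lambda>u. measure \<mu> (cylinder u)"
  define h where "h u k = - real k * P + (\<Sum>j<k. f ((shift ^^ j) u))" for u k
  have g: "a * exp (h u k) \<le> ?m (prefix_of u k)" "?m (prefix_of u k) \<le> exp (h u k) / a" for u k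
    using gibbs[of u k] a unfolding Let_def h_def[symmetric] by (simp_all add: field_simps)
  have pos: "?m w > 0" for w
  proof -
    obtain u where "prefix_of u (length w) = w" using ex_prefix_of by blast
    moreover have "0 < a * exp (h u (length w))" using a by simp
    ultimately show ?thesis using g(1)[of u "length w"] by (metis less_le_trans)
  qed
  have ln_bound: "\<bar>ln (?m (prefix_of u k)) - h u k\<bar> \<le> - ln a" for u k
  proof -
    have "ln (a * exp (h u k)) \<le> ln (?m (prefix_of u k))" "ln (?m (prefix_of u k)) \<le> ln (exp (h u k) / a)"
      using g[of u k] pos[of "prefix_of u k"] a by (simp_all add: ln_mono)
    then show ?thesis using a by (simp add: ln_mult ln_div)
  qed
  have "\<bar>ln (?m (v @ w)) - ln (?m v) - ln (?m w)\<bar> \<le> 3 * (- ln a)" for v w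
  proof -
    \<comment> \<open>Any infinite extension of v @ w serves, because the Gibbs bounds hold at every
      point of a cylinder.\<close>
    obtain u where u: "prefix_of u (length v + length w) = v @ w"
      using ex_prefix_of[of "v @ w"] by auto
    let ?k = "length v" and ?l = "length w" and ?s = "(shift ^^ length v) u"
    have vw: "prefix_of u ?k = v" "prefix_of ?s ?l = w"
      using u by (auto simp: prefix_of_add)
    have split: "(\<Sum>j<?k + l. f ((shift ^^ j) u)) =
        (\<Sum>j<?k. f ((shift ^^ j) u)) + (\<Sum>j<l. f ((shift ^^ j) ?s))" for l
      by (induction l) (auto simp: add.commute[of ?k] funpow_add)
    have "h u (?k + ?l) = h u ?k + h ?s ?l"
      unfolding h_def split of_nat_add by (simp add: algebra_simps)
    then show ?thesis
      using ln_bound[of u "?k + ?l"] ln_bound[of u ?k] ln_bound[of ?s ?l] by (simp add: u vw)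
  qed
  then show ?thesis using pos unfolding quasi_multiplicative_def by blast
qed

subsection \<open>Mesh sums\<close>

text \<open>A sum of at most N terms is at most N times its largest term, so its q-th power is at
  most N^q times the sum of the q-th powers, for q below and above 1. After exchanging the
  summations each a is counted at most N' times. The relation R allows words and cubes to swap
  roles.\<close>

lemma sum_powr_le_of_bounded_multiplicity:
  fixes f :: "'a \<Rightarrow> real" and g :: "'b \<Rightarrow> real"
  assumes fin: "finite A" "finite B" and f: "\<And>a. a \<in> A \<Longrightarrow> f a \<ge> 0" and g: "\<And>b. b \<in> B \<Longrightarrow> g b \<ge> 0"
    and q: "q > 0"
    and le: "\<And>b. b \<in> B \<Longrightarrow> g b \<le> (\<Sum>a | a \<in> A \<and> R a b. f a)"
    and cardA: "\<And>b. b \<in> B \<Longrightarrow> real (card {a. a \<in> A \<and> R a b}) \<le> N"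
    and cardB: "\<And>a. a \<in> A \<Longrightarrow> real (card {b. b \<in> B \<and> R a b}) \<le> N'"
  shows "(\<Sum>b\<in>B. g b powr q) \<le> N powr q * N' * (\<Sum>a\<in>A. f a powr q)"
proof -
  have "g b powr q \<le> N powr q * (\<Sum>a | a \<in> A \<and> R a b. f a powr q)" if b: "b \<in> B" for b
  proof (cases "{a. a \<in> A \<and> R a b} = {}")
    case True
    then show ?thesis using le[OF b] g[OF b] by (simp add: True)
  next
    case False
    let ?A = "{a. a \<in> A \<and> R a b}"
    have finA: "finite ?A" using fin(1) by simp
    have "Max (f ` ?A) \<in> f ` ?A" by (rule Max_in) (use finA False in auto)
    then obtain a where a: "Max (f ` ?A) = f a" "a \<in> ?A" by (rule imageE)
    have "g b \<le> (\<Sum>a\<in>?A. f a)" by (rule le[OF b])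
    also have "\<dots> \<le> (\<Sum>x\<in>?A. f a)" unfolding a(1)[symmetric] using finA by (intro sum_mono Max_ge) auto
    also have "\<dots> \<le> N * f a" using cardA[OF b] f a(2) by (simp add: mult_right_mono)
    finally have "g b powr q \<le> (N * f a) powr q" using g[OF b] q by (intro powr_mono2) auto
    also have "\<dots> = N powr q * f a powr q"
      using cardA[OF b] f a(2) by (simp add: powr_mult)
    also have "\<dots> \<le> N powr q * (\<Sum>a\<in>?A. f a powr q)"
      using member_le_sum[of a ?A "\<lambda>a. f a powr q"] a(2) finA by (intro mult_left_mono) auto
    finally show ?thesis .
  qed
  then have "(\<Sum>b\<in>B. g b powr q) \<le> N powr q * (\<Sum>b\<in>B. \<Sum>a | a \<in> A \<and> R a b. f a powr q)"
    unfolding sum_distrib_left by (intro sum_mono)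
  also have "(\<Sum>b\<in>B. \<Sum>a | a \<in> A \<and> R a b. f a powr q) = (\<Sum>a\<in>A. \<Sum>b | b \<in> B \<and> R a b. f a powr q)"
    by (rule sum.swap_restrict[OF fin(2,1)])
  also have "\<dots> \<le> (\<Sum>a\<in>A. N' * f a powr q)"
    using cardB by (intro sum_mono) (simp add: mult_right_mono)
  finally show ?thesis by (simp add: sum_distrib_left mult.assoc mult_left_mono)
qed

lemma int_vec_interval:
  fixes m :: "int ^ 'd" and k :: nat
  shows finite_int_vec_interval: "finite {m'. \<forall>j. \<bar>m' $ j - m $ j\<bar> \<le> int k}"
    and card_int_vec_interval_le: "card {m'. \<forall>j. \<bar>m' $ j - m $ j\<bar> \<le> int k} \<le> (2 * k + 1) ^ CARD('d)"
proof -
  let ?P = "PiE UNIV (\<lambda>j. {m $ j - int k .. m $ j + int k})"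
  have fin: "finite ?P" by (intro finite_PiE) auto
  have sub: "{m'. \<forall>j. \<bar>m' $ j - m $ j\<bar> \<le> int k} \<subseteq> vec_lambda ` ?P"
  proof
    fix m' assume "m' \<in> {m'. \<forall>j. \<bar>m' $ j - m $ j\<bar> \<le> int k}"
    then have "\<bar>m' $ j - m $ j\<bar> \<le> int k" for j by simp
    then have "(\<lambda>j. m' $ j) \<in> ?P" by (auto simp: PiE_UNIV_domain abs_le_iff algebra_simps)
    then show "m' \<in> vec_lambda ` ?P" by (intro image_eqI[of _ _ "\<lambda>j. m' $ j"]) auto
  qed
  then show "finite {m'. \<forall>j. \<bar>m' $ j - m $ j\<bar> \<le> int k}" using fin finite_surj by blast
  have "card {m'. \<forall>j. \<bar>m' $ j - m $ j\<bar> \<le> int k} \<le> card ?P"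
    using surj_card_le[OF fin sub] .
  also have "\<dots> = (2 * k + 1) ^ CARD('d)" by (simp add: card_PiE nat_add_distrib nat_mult_distrib)
  finally show "card {m'. \<forall>j. \<bar>m' $ j - m $ j\<bar> \<le> int k} \<le> (2 * k + 1) ^ CARD('d)" .
qed

lemma mesh_cube_floor: "\<delta> > 0 \<Longrightarrow> x \<in> mesh_cube \<delta> (\<chi> j. \<lfloor>x $ j / \<delta>\<rfloor>)"
  by (simp add: mesh_cube_def pos_le_divide_eq[symmetric] pos_divide_less_eq[symmetric])

lemma mesh_cube_borel: "mesh_cube \<delta> m \<in> sets (borel :: (real ^ 'd) measure)"
proof -
  have "mesh_cube \<delta> m = (\<Inter>j. {x. of_int (m $ j) * \<delta> \<le> x $ j} \<inter> {x. x $ j < (of_int (m $ j) + 1) * \<delta>})"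
    by (auto simp: mesh_cube_def)
  moreover have "closed {x :: real ^ 'd. c \<le> x $ j}" "open {x :: real ^ 'd. x $ j < c}" for c j
    by (intro closed_Collect_le open_Collect_less continuous_intros)+
  ultimately show ?thesis by auto
qed

lemma mesh_cube_diam:
  fixes x y :: "real ^ 'd"
  assumes "x \<in> mesh_cube \<delta> m" "y \<in> mesh_cube \<delta> m"
  shows "norm (x - y) \<le> real CARD('d) * \<delta>"
proof -
  have "norm (x - y) \<le> (\<Sum>j\<in>UNIV. \<bar>(x - y) $ j\<bar>)" by (rule norm_le_l1_cart)
  also have "\<dots> \<le> (\<Sum>j\<in>(UNIV :: 'd set). \<delta>)"
  proof (rule sum_mono)
    fix j
    have "of_int (m $ j) * \<delta> \<le> x $ j" "x $ j < (of_int (m $ j) + 1) * \<delta>"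
      "of_int (m $ j) * \<delta> \<le> y $ j" "y $ j < (of_int (m $ j) + 1) * \<delta>"
      using assms by (auto simp: mesh_cube_def)
    then show "\<bar>(x - y) $ j\<bar> \<le> \<delta>" by (simp add: abs_le_iff algebra_simps)
  qed
  finally show ?thesis by simp
qed

lemma mesh_cubes_meeting_subset:
  fixes S :: "(real ^ 'd) set"
  assumes "\<delta> > 0" and diam: "\<And>x y. x \<in> S \<Longrightarrow> y \<in> S \<Longrightarrow> norm (x - y) \<le> real k * \<delta>"
    and m0: "mesh_cube \<delta> m0 \<inter> S \<noteq> {}"
  shows "{m. mesh_cube \<delta> m \<inter> S \<noteq> {}} \<subseteq> {m. \<forall>j. \<bar>m $ j - m0 $ j\<bar> \<le> int (k + 1)}"
proof (intro subsetI CollectI allI)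
  have *: "m $ j \<le> m' $ j + int (k + 1)"
    if "x \<in> mesh_cube \<delta> m" "x \<in> S" "y \<in> mesh_cube \<delta> m'" "y \<in> S" for x y and m m' :: "int ^ 'd" and j
  proof -
    have "of_int (m $ j) * \<delta> \<le> x $ j" "y $ j < (of_int (m' $ j) + 1) * \<delta>"
      using that by (auto simp: mesh_cube_def)
    moreover have "x $ j - y $ j \<le> real k * \<delta>"
      using diam[OF that(2,4)] component_le_norm_cart[of "x - y" j] by simp
    \<comment> \<open>The 1 is the side of the second cube, added to the distance k inside S, both
      in units of \<delta>.\<close>
    ultimately have "of_int (m $ j) * \<delta> < (of_int (m' $ j) + 1 + real k) * \<delta>"
      by (simp add: algebra_simps)
    then have "real_of_int (m $ j) < of_int (m' $ j + int (k + 1))" using assms(1) by simp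
    then show ?thesis by linarith
  qed
  fix m j assume "m \<in> {m. mesh_cube \<delta> m \<inter> S \<noteq> {}}"
  then obtain x where "x \<in> mesh_cube \<delta> m" "x \<in> S" by blast
  moreover obtain y where "y \<in> mesh_cube \<delta> m0" "y \<in> S" using m0 by blast
  ultimately show "\<bar>m $ j - m0 $ j\<bar> \<le> int (k + 1)" using *[of x m y m0 j] *[of y m0 x m j] by simp
qed

lemma mesh_cubes_meeting:
  fixes S :: "(real ^ 'd) set"
  assumes "\<delta> > 0" and diam: "\<And>x y. x \<in> S \<Longrightarrow> y \<in> S \<Longrightarrow> norm (x - y) \<le> real k * \<delta>"
  shows finite_mesh_cubes_meeting: "finite {m. mesh_cube \<delta> m \<inter> S \<noteq> {}}"
    and card_mesh_cubes_meeting_le: "card {m. mesh_cube \<delta> m \<inter> S \<noteq> {}} \<le> (2 * (k + 1) + 1) ^ CARD('d)"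
proof -
  have "finite {m. mesh_cube \<delta> m \<inter> S \<noteq> {}} \<and> card {m. mesh_cube \<delta> m \<inter> S \<noteq> {}} \<le> (2 * (k + 1) + 1) ^ CARD('d)"
  proof (cases "{m. mesh_cube \<delta> m \<inter> S \<noteq> {}} = {}")
    case True
    then show ?thesis by (metis card.empty finite.emptyI le0)
  next
    case False
    then obtain m0 where "mesh_cube \<delta> m0 \<inter> S \<noteq> {}" by blast
    from mesh_cubes_meeting_subset[OF assms this]
    have sub: "{m. mesh_cube \<delta> m \<inter> S \<noteq> {}} \<subseteq> {m. \<forall>j. \<bar>m $ j - m0 $ j\<bar> \<le> int (k + 1)}" .
    show ?thesis
      using finite_subset[OF sub finite_int_vec_interval]
        card_mono[OF finite_int_vec_interval sub] card_int_vec_interval_le[of m0 "k + 1"] by linarith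
  qed
  then show "finite {m. mesh_cube \<delta> m \<inter> S \<noteq> {}}"
    "card {m. mesh_cube \<delta> m \<inter> S \<noteq> {}} \<le> (2 * (k + 1) + 1) ^ CARD('d)" by blast+
qed

lemma mesh_sum_finite:
  assumes "finite M" "\<And>m. m \<notin> M \<Longrightarrow> measure \<nu> (mesh_cube \<delta> m) = 0"
  shows "mesh_sum \<nu> q \<delta> = ennreal (\<Sum>m\<in>M. measure \<nu> (mesh_cube \<delta> m) powr q)"
proof -
  have "mesh_sum \<nu> q \<delta> = (\<Sum>\<^sub>\<infinity>m\<in>M. ennreal (measure \<nu> (mesh_cube \<delta> m) powr q))"
    \<comment> \<open>A cube of measure zero contributes 0 powr q = 0.\<close>
    unfolding mesh_sum_def using assms(2) by (intro infsum_cong_neutral) auto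
  then show ?thesis using assms(1) by (simp add: sum_ennreal)
qed

text \<open>The constant K adds a bounded term to ln (M \<delta>), which vanishes on division by (q
  - 1) * ln \<delta> as \<delta> tends to 0. The main term - s * ln \<delta> leaves s / (1 -
  q).\<close>

lemma has_gen_dimI:
  fixes \<nu> :: "(real ^ 'd) measure"
  assumes q: "q \<noteq> 1" and K: "K > 0"
    and M: "\<And>\<delta>. 0 < \<delta> \<Longrightarrow> \<delta> < 1 \<Longrightarrow> mesh_sum \<nu> q \<delta> = ennreal (M \<delta>)"
    and bounds: "\<And>\<delta>. 0 < \<delta> \<Longrightarrow> \<delta> < 1 \<Longrightarrow> \<delta> powr - s \<le> K * M \<delta>"
      "\<And>\<delta>. 0 < \<delta> \<Longrightarrow> \<delta> < 1 \<Longrightarrow> M \<delta> \<le> K * \<delta> powr - s"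
  shows "has_gen_dim \<nu> q (ereal (s / (1 - q)))"
proof -
  have ev: "\<forall>\<^sub>F \<delta> in at_right 0. 0 < \<delta> \<and> \<delta> < (1::real)"
    using eventually_at_right_real[of 0 1] by (simp add: eventually_mono)
  have Mpos: "M \<delta> > 0" if "0 < \<delta>" "\<delta> < 1" for \<delta>
  proof -
    have "0 < \<delta> powr - s" using that by simp
    also have "\<dots> \<le> K * M \<delta>" by (rule bounds(1)[OF that])
    finally have "0 < K * M \<delta>" .
    then show ?thesis using K by (simp add: zero_less_mult_iff)
  qed
  let ?Q = "\<lambda>\<delta>. ln (M \<delta>) / ((q - 1) * ln \<delta>)"
  have dq: "dim_quotient \<nu> q \<delta> = ereal (?Q \<delta>)" if "0 < \<delta>" "\<delta> < 1" for \<delta>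
  proof -
    have "(q - 1) * ln \<delta> \<noteq> 0" using q that by simp
    then show ?thesis using Mpos[OF that] by (simp add: dim_quotient_def ext_ln_def M[OF that])
  qed
  have close: "norm (?Q \<delta> - s / (1 - q)) \<le> \<bar>ln K / (q - 1)\<bar> * \<bar>inverse (ln \<delta>)\<bar>" if \<delta>: "0 < \<delta>" "\<delta> < 1" for \<delta>
  proof -
    have "ln (\<delta> powr - s) \<le> ln (K * M \<delta>)" "ln (M \<delta>) \<le> ln (K * \<delta> powr - s)"
      using bounds[OF \<delta>] K Mpos[OF \<delta>] \<delta> by (auto intro!: ln_mono simp del: ln_powr)
    then have "\<bar>ln (M \<delta>) + s * ln \<delta>\<bar> \<le> ln K"
      using K Mpos[OF \<delta>] \<delta> by (simp add: ln_mult ln_powr abs_le_iff)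
    moreover have "?Q \<delta> - s / (1 - q) = (ln (M \<delta>) + s * ln \<delta>) / ((q - 1) * ln \<delta>)"
      using q \<delta> by (simp add: divide_simps) (simp add: algebra_simps)
    ultimately have "norm (?Q \<delta> - s / (1 - q)) \<le> \<bar>ln K\<bar> / \<bar>(q - 1) * ln \<delta>\<bar>"
      by (simp add: abs_divide divide_right_mono)
    then show ?thesis by (simp add: abs_divide abs_mult abs_inverse divide_inverse mult_ac)
  qed
  have "((\<lambda>\<delta>. \<bar>ln K / (q - 1)\<bar> * \<bar>inverse (ln \<delta>)\<bar>) \<longlongrightarrow> \<bar>ln K / (q - 1)\<bar> * \<bar>0\<bar>) (at_right 0)"
    by (intro tendsto_intros filterlim_compose[OF tendsto_inverse_0] filterlim_at_bot_imp_at_infinity ln_at_0)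
  then have "((\<lambda>\<delta>. \<bar>ln K / (q - 1)\<bar> * \<bar>inverse (ln \<delta>)\<bar>) \<longlongrightarrow> 0) (at_right 0)" by simp
  then have "((\<lambda>\<delta>. ?Q \<delta> - s / (1 - q)) \<longlongrightarrow> 0) (at_right 0)"
    by (rule Lim_null_comparison[rotated]) (use ev close in \<open>auto elim: eventually_mono\<close>)
  then have "(?Q \<longlongrightarrow> s / (1 - q)) (at_right 0)" by (rule LIM_zero_cancel)
  then have "((\<lambda>\<delta>. ereal (?Q \<delta>)) \<longlongrightarrow> ereal (s / (1 - q))) (at_right 0)" by (rule tendsto_ereal)
  then have "(dim_quotient \<nu> q \<longlongrightarrow> ereal (s / (1 - q))) (at_right 0)"
    by (rule Lim_transform_eventually) (use ev dq in \<open>auto elim: eventually_mono\<close>)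
  then show ?thesis
    by (simp add: has_gen_dim_def lower_gen_dim_def upper_gen_dim_def lim_imp_Liminf lim_imp_Limsup)
qed

subsection \<open>The image measure\<close>

context acifs
begin

lemma ratio_eventually_small:
  assumes "\<epsilon> > 0"
  obtains n where "\<And>u. length u \<ge> n \<Longrightarrow> ratio u < \<epsilon>"
proof -
  obtain c D where c: "0 < c" "c < 1" "\<And>u. ratio u \<le> D * c ^ length u"
    using ratio_exponential_decay by metis
  have D: "D > 0" using c(3)[of "[]"] ratio_Nil by simp
  have "(\<lambda>n. D * c ^ n) \<longlonglongrightarrow> D * 0" using c by (intro tendsto_intros LIMSEQ_realpow_zero) auto
  then have "\<forall>\<^sub>F n in sequentially. D * c ^ n < \<epsilon>" using assms by (intro order_tendstoD) auto
  then obtain n where n: "\<And>m. m \<ge> n \<Longrightarrow> D * c ^ m < \<epsilon>" by (auto simp: eventually_sequentially)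
  show ?thesis
  proof (rule that)
    show "ratio u < \<epsilon>" if "length u \<ge> n" for u using c(3)[of u] n[OF that] by simp
  qed
qed

text \<open>Nested nonempty compact sets have a common point, and diameters tending to zero make it
  unique, so the \<open>THE\<close> in \<open>coding_map\<close> is well defined.\<close>

lemma coding_map_in: "coding_map Jw u \<in> Jw (prefix_of u n)"
proof -
  let ?F = "\<lambda>n. Jw (prefix_of u n)"
  have mono: "?F n \<subseteq> ?F m" if "m \<le> n" for m n
    using Jw_append[of "prefix_of u m" "prefix_of ((shift ^^ m) u) (n - m)"] that
    by (simp flip: prefix_of_add)
  have "\<Inter> (range ?F) \<noteq> {}"
    by (rule compact_nest) (simp_all add: Jw_compact Jw_nonempty mono)
  then obtain x where x: "\<And>n. x \<in> ?F n" by auto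
  obtain L where L: "L > 0" "\<And>u x y. x \<in> Jw u \<Longrightarrow> y \<in> Jw u \<Longrightarrow> norm (x - y) \<le> L * ratio u"
    using Jw_diam by metis
  have "y = x" if y: "\<And>n. n \<ge> 1 \<Longrightarrow> y \<in> ?F n" for y
  proof (rule ccontr)
    assume "y \<noteq> x"
    then have "norm (y - x) / L > 0" using L(1) by simp
    then obtain n where n: "\<And>u. length u \<ge> n \<Longrightarrow> ratio u < norm (y - x) / L"
      using ratio_eventually_small by metis
    \<comment> \<open>The intersection in \<open>coding_map\<close> starts at index 1, hence max n
      1.\<close>
    have "norm (y - x) \<le> L * ratio (prefix_of u (max n 1))" using L(2) x y by simp
    also have "\<dots> < norm (y - x)" using n[of "prefix_of u (max n 1)"] L(1) by (simp add: field_simps)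
    finally show False by simp
  qed
  then have "(\<Inter>n\<in>{1..}. ?F n) = {x}" using x by fastforce
  then have "coding_map Jw u = x" unfolding coding_map_def by (intro the_equality) auto
  then show ?thesis using x by simp
qed

text \<open>The coding map is continuous: words with a long common prefix are sent into one small
  \<open>Jw\<close>.\<close>

lemma coding_map_measurable:
  assumes "sets \<mu> = sets word_borel"
  shows "coding_map Jw \<in> borel_measurable \<mu>"
proof (rule borel_measurableI)
  fix S :: "(real ^ 'd) set" assume S: "open S"
  obtain L where L: "L > 0" "\<And>u x y. x \<in> Jw u \<Longrightarrow> y \<in> Jw u \<Longrightarrow> norm (x - y) \<le> L * ratio u"
    using Jw_diam by metis
  have "openin word_topology (coding_map Jw -` S)"
  proof (rule openin_word_topologyI)
    fix u assume "u \<in> coding_map Jw -` S"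
    then obtain e where e: "e > 0" "ball (coding_map Jw u) e \<subseteq> S"
      using S by (auto simp: open_contains_ball)
    have "e / L > 0" using e L by simp
    then obtain n where n: "\<And>u. length u \<ge> n \<Longrightarrow> ratio u < e / L"
      using ratio_eventually_small by metis
    have "coding_map Jw v \<in> S" if "v \<in> cylinder (prefix_of u n)" for v
    proof -
      have "coding_map Jw v \<in> Jw (prefix_of u n)"
        using that coding_map_in[of v n] by (simp add: cylinder_eqI)
      then have "norm (coding_map Jw u - coding_map Jw v) \<le> L * ratio (prefix_of u n)"
        using L(2) coding_map_in by blast
      also have "\<dots> < e" using n[of "prefix_of u n"] L(1) by (simp add: field_simps)
      finally show ?thesis using e(2) by (auto simp: dist_norm)
    qed
    then show "\<exists>n. cylinder (prefix_of u n) \<subseteq> coding_map Jw -` S" by blast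
  qed
  moreover have "space \<mu> = UNIV" using sets_eq_imp_space_eq[OF assms] space_word_borel by simp
  ultimately show "coding_map Jw -` S \<inter> space \<mu> \<in> sets \<mu>"
    unfolding assms by (auto simp: word_borel_def sets_measure_of_conv)
qed

section \<open>The cut at scale \<delta> against the mesh\<close>

lemma is_cut_stopping_ratio:
  assumes "\<delta> > 0"
  shows "\<exists>n. is_cut n (stopping_words ratio \<delta>)"
proof -
  obtain n where "\<And>u. length u \<ge> n \<Longrightarrow> ratio u < \<delta>" using ratio_eventually_small[OF assms] by metis
  then have "is_cut n (stopping_words ratio \<delta>)" by (intro is_cut_stopping_words) (simp add: less_imp_le)
  then show ?thesis ..
qed

lemma finite_stopping_ratio: "\<delta> > 0 \<Longrightarrow> finite (stopping_words ratio \<delta>)"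
  using is_cut_stopping_ratio is_cut_finite by blast

lemma ex_prefix_in_stopping_ratio:
  assumes "\<delta> > 0"
  shows "\<exists>n. prefix_of u n \<in> stopping_words ratio \<delta>"
proof -
  obtain n where "is_cut n (stopping_words ratio \<delta>)" using is_cut_stopping_ratio[OF assms] ..
  then obtain k where "k \<le> n" "take k (prefix_of u n) \<in> stopping_words ratio \<delta>"
    unfolding is_cut_def by (metis length_prefix_of)
  then show ?thesis by (auto simp: take_prefix_of)
qed

lemma stopping_ratio_overlap:
  assumes "open_set_condition Jw"
  obtains N where "N \<ge> 1"
    "\<And>\<delta> m. 0 < \<delta> \<Longrightarrow> \<delta> < 1 \<Longrightarrow>
       real (card {u. u \<in> stopping_words ratio \<delta> \<and> Jw u \<inter> mesh_cube \<delta> m \<noteq> {}}) \<le> N"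
    "\<And>\<delta> u. 0 < \<delta> \<Longrightarrow> u \<in> stopping_words ratio \<delta> \<Longrightarrow>
       finite {m. Jw u \<inter> mesh_cube \<delta> m \<noteq> {}} \<and> real (card {m. Jw u \<inter> mesh_cube \<delta> m \<noteq> {}}) \<le> N"
proof -
  obtain L where L: "L > 0" "\<And>u x y. x \<in> Jw u \<Longrightarrow> y \<in> Jw u \<Longrightarrow> norm (x - y) \<le> L * ratio u"
    using Jw_diam by metis
  obtain \<kappa> where \<kappa>: "\<kappa> > 0" "\<And>u. \<exists>z. ball z (\<kappa> * ratio u) \<subseteq> interior (Jw u)"
    using Jw_contains_ball by metis
  obtain B where "quasi_multiplicative B ratio" using quasi_multiplicative_ratio by blast
  then obtain b where b: "0 < b" "\<And>\<delta> u. \<delta> < ratio [] \<Longrightarrow> u \<in> stopping_words ratio \<delta> \<Longrightarrow> b * \<delta> \<le> ratio u"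
    using quasi_multiplicative_stopping_lower[of B ratio] by metis
  have upper: "norm (x - y) \<le> L * \<delta>" if "u \<in> stopping_words ratio \<delta>" "x \<in> Jw u" "y \<in> Jw u" for u \<delta> x y
  proof -
    have "norm (x - y) \<le> L * ratio u" using L(2) that by blast
    also have "\<dots> \<le> L * \<delta>" using that(1) L(1) by (simp add: stopping_words_def)
    finally show ?thesis .
  qed
  \<comment> \<open>R * \<delta> bounds the distance from a point of a cube to any point of a
    \<open>Jw u\<close> meeting it: the diameter of the cube plus that of \<open>Jw u\<close>. N1 is
    the resulting volume ratio, in which \<delta> cancels.\<close>
  define R where "R = L + real CARD('d)"
  define N1 where "N1 = (R / (\<kappa> * b)) ^ CARD('d)"
  obtain k where k: "L \<le> real k" using real_arch_simple by blast
  define N2 where "N2 = real ((2 * (k + 1) + 1) ^ CARD('d))"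
  have N1: "real (card {u. u \<in> stopping_words ratio \<delta> \<and> Jw u \<inter> mesh_cube \<delta> m \<noteq> {}}) \<le> N1"
    if \<delta>: "0 < \<delta>" "\<delta> < 1" for \<delta> m
  proof (cases "mesh_cube \<delta> m = {}")
    case True
    have "0 \<le> N1" using L(1) \<kappa>(1) b(1) by (simp add: N1_def R_def)
    then show ?thesis using True by simp
  next
    case False
    then obtain c where c: "c \<in> mesh_cube \<delta> m" by blast
    let ?A = "{u. u \<in> stopping_words ratio \<delta> \<and> Jw u \<inter> mesh_cube \<delta> m \<noteq> {}}"
    have "\<exists>z. ball z (\<kappa> * (b * \<delta>)) \<subseteq> interior (Jw u)" if "u \<in> stopping_words ratio \<delta>" for u
    proof -
      have "\<kappa> * (b * \<delta>) \<le> \<kappa> * ratio u" using b(2)[OF _ that] \<delta> \<kappa>(1) by (simp add: ratio_Nil)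
      then show ?thesis using \<kappa>(2)[of u] by (meson subset_ball subset_trans)
    qed
    then obtain z where z: "\<And>u. u \<in> stopping_words ratio \<delta> \<Longrightarrow> ball (z u) (\<kappa> * (b * \<delta>)) \<subseteq> interior (Jw u)"
      by metis
    have "real (card ?A) \<le> (R * \<delta> / (\<kappa> * (b * \<delta>))) ^ DIM(real ^ 'd)"
    proof (rule card_disjoint_balls_le)
      show "finite ?A" using finite_stopping_ratio[OF \<delta>(1)] by simp
      show "disjoint_family_on (\<lambda>u. ball (z u) (\<kappa> * (b * \<delta>))) ?A"
        unfolding disjoint_family_on_def
      proof (intro ballI impI)
        fix u v assume uv: "u \<in> ?A" "v \<in> ?A" "u \<noteq> v"
        then have "interior (Jw u) \<inter> interior (Jw v) = {}"
          by (intro interior_Jw_disjoint[OF assms] stopping_words_parallel[of u ratio \<delta> v]) auto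
        moreover have "ball (z u) (\<kappa> * (b * \<delta>)) \<subseteq> interior (Jw u)" "ball (z v) (\<kappa> * (b * \<delta>)) \<subseteq> interior (Jw v)"
          using uv by (auto intro!: z)
        ultimately show "ball (z u) (\<kappa> * (b * \<delta>)) \<inter> ball (z v) (\<kappa> * (b * \<delta>)) = {}" by blast
      qed
      show "ball (z u) (\<kappa> * (b * \<delta>)) \<subseteq> cball c (R * \<delta>)" if "u \<in> ?A" for u
      proof
        fix y assume "y \<in> ball (z u) (\<kappa> * (b * \<delta>))"
        then have y: "y \<in> Jw u" using z that interior_subset by blast
        obtain x where x: "x \<in> Jw u" "x \<in> mesh_cube \<delta> m" using \<open>u \<in> ?A\<close> by blast
        have "norm (c - y) \<le> norm (c - x) + norm (x - y)"
          using norm_triangle_ineq[of "c - x" "x - y"] by simp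
        also have "\<dots> \<le> real CARD('d) * \<delta> + L * \<delta>"
          using mesh_cube_diam[OF c x(2)] upper[OF _ x(1) y] that by (intro add_mono) auto
        finally show "y \<in> cball c (R * \<delta>)" by (simp add: dist_norm R_def algebra_simps)
      qed
    qed (use \<kappa> b \<delta> L in \<open>auto simp: R_def\<close>)
    also have "\<dots> = N1" using \<delta> by (simp add: N1_def)
    finally show ?thesis .
  qed
  have N2: "finite {m. Jw u \<inter> mesh_cube \<delta> m \<noteq> {}} \<and> real (card {m. Jw u \<inter> mesh_cube \<delta> m \<noteq> {}}) \<le> N2"
    if \<delta>: "0 < \<delta>" and u: "u \<in> stopping_words ratio \<delta>" for \<delta> u
  proof -
    have diam: "norm (x - y) \<le> real k * \<delta>" if "x \<in> Jw u" "y \<in> Jw u" for x y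
      using upper[OF u that] k \<delta> by (meson less_imp_le mult_right_mono order_trans)
    show ?thesis
      using finite_mesh_cubes_meeting[OF \<delta> diam] card_mesh_cubes_meeting_le[OF \<delta> diam]
      unfolding N2_def of_nat_le_iff by (simp add: Int_commute)
  qed
  show ?thesis
  proof (rule that[of "max 1 (max N1 N2)"])
    show "real (card {u. u \<in> stopping_words ratio \<delta> \<and> Jw u \<inter> mesh_cube \<delta> m \<noteq> {}}) \<le> max 1 (max N1 N2)"
      if "0 < \<delta>" "\<delta> < 1" for \<delta> m using N1[OF that, of m] by simp
    show "finite {m. Jw u \<inter> mesh_cube \<delta> m \<noteq> {}} \<and>
        real (card {m. Jw u \<inter> mesh_cube \<delta> m \<noteq> {}}) \<le> max 1 (max N1 N2)"
      if "0 < \<delta>" "u \<in> stopping_words ratio \<delta>" for \<delta> u using N2[OF that] by auto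
  qed simp
qed

text \<open>Two covering arguments on the word space: the preimage of a cube is covered by the
  cylinders whose \<open>Jw u\<close> meets the cube, and a cylinder by the preimages of the cubes
  that its \<open>Jw u\<close> meets. The bounded multiplicities convert both into estimates for
  q-th powers.\<close>

lemma mesh_sum_comparable:
  assumes osc: "open_set_condition Jw" and prob: "prob_space \<mu>" and sets: "sets \<mu> = sets word_borel"
    and q: "q > 0"
  obtains M K where "K > 0"
    "\<And>\<delta>. 0 < \<delta> \<Longrightarrow> \<delta> < 1 \<Longrightarrow> mesh_sum (image_measure Jw \<mu>) q \<delta> = ennreal (M \<delta>)"
    "\<And>\<delta>. 0 < \<delta> \<Longrightarrow> \<delta> < 1 \<Longrightarrow> M \<delta> \<le> K * (\<Sum>u\<in>stopping_words ratio \<delta>. measure \<mu> (cylinder u) powr q)"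
    "\<And>\<delta>. 0 < \<delta> \<Longrightarrow> \<delta> < 1 \<Longrightarrow> (\<Sum>u\<in>stopping_words ratio \<delta>. measure \<mu> (cylinder u) powr q) \<le> K * M \<delta>"
proof -
  interpret prob_space \<mu> by (rule prob)
  let ?\<pi> = "coding_map Jw" and ?\<nu> = "image_measure Jw \<mu>"
  obtain N where N: "N \<ge> 1"
    "\<And>\<delta> m. 0 < \<delta> \<Longrightarrow> \<delta> < 1 \<Longrightarrow>
       real (card {u. u \<in> stopping_words ratio \<delta> \<and> Jw u \<inter> mesh_cube \<delta> m \<noteq> {}}) \<le> N"
    "\<And>\<delta> u. 0 < \<delta> \<Longrightarrow> u \<in> stopping_words ratio \<delta> \<Longrightarrow>
       finite {m. Jw u \<inter> mesh_cube \<delta> m \<noteq> {}} \<and> real (card {m. Jw u \<inter> mesh_cube \<delta> m \<noteq> {}}) \<le> N"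
    by (rule stopping_ratio_overlap[OF osc]) (rule that; blast)
  have space: "space \<mu> = UNIV" using sets_eq_imp_space_eq[OF sets] space_word_borel by simp
  have \<pi>: "?\<pi> \<in> borel_measurable \<mu>" by (rule coding_map_measurable[OF sets])
  have cyl: "cylinder u \<in> events" for u using cylinder_in_sets sets by auto
  have cyl_Jw: "?\<pi> v \<in> Jw u" if "v \<in> cylinder u" for u v
    using coding_map_in[of v "length u"] that by (simp add: cylinder_def)
  have cube: "?\<pi> -` mesh_cube \<delta> m \<in> events" for \<delta> m
    using measurable_sets[OF \<pi> mesh_cube_borel[of \<delta> m]] by (simp add: space)
  have \<nu>: "measure ?\<nu> (mesh_cube \<delta> m) = prob (?\<pi> -` mesh_cube \<delta> m)" for \<delta> m
    unfolding image_measure_def using measure_distr[OF \<pi> mesh_cube_borel] by (simp add: space)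
  let ?m = "\<lambda>u. prob (cylinder u)"
  \<comment> \<open>The image measure lives on the bounded set \<open>J\<close>, so finitely many
    cubes carry the whole mesh sum.\<close>
  define cubes where "cubes \<delta> = {m. mesh_cube \<delta> m \<inter> J \<noteq> {}}" for \<delta>
  have fin_cubes: "finite (cubes \<delta>)" if \<delta>: "\<delta> > 0" for \<delta>
  proof -
    obtain D where D: "\<And>x y. x \<in> J \<Longrightarrow> y \<in> J \<Longrightarrow> dist x y \<le> D"
      using compact_imp_bounded[OF compact_J] unfolding bounded_two_points by blast
    obtain k where "D / \<delta> \<le> real k" using real_arch_simple by blast
    then have "norm (x - y) \<le> real k * \<delta>" if "x \<in> J" "y \<in> J" for x y
      using D[OF that] \<delta> by (simp add: dist_norm field_simps)
    then show ?thesis unfolding cubes_def by (rule finite_mesh_cubes_meeting[OF \<delta>])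
  qed
  define M where "M \<delta> = (\<Sum>m\<in>cubes \<delta>. measure ?\<nu> (mesh_cube \<delta> m) powr q)" for \<delta>
  have mesh: "mesh_sum ?\<nu> q \<delta> = ennreal (M \<delta>)" if "0 < \<delta>" for \<delta>
  proof -
    have "measure ?\<nu> (mesh_cube \<delta> m) = 0" if "m \<notin> cubes \<delta>" for m
    proof -
      have "?\<pi> u \<in> J" for u using coding_map_in[of u 0] Jw_subset by blast
      then have "?\<pi> -` mesh_cube \<delta> m = {}" using that by (auto simp: cubes_def)
      then show ?thesis by (simp add: \<nu>)
    qed
    then show ?thesis unfolding M_def by (intro mesh_sum_finite fin_cubes \<open>0 < \<delta>\<close>)
  qed
  let ?R = "\<lambda>\<delta> u m. Jw u \<inter> mesh_cube \<delta> m \<noteq> {}"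
  have cardB: "real (card {m. m \<in> cubes \<delta> \<and> ?R \<delta> u m}) \<le> N"
    if "0 < \<delta>" "u \<in> stopping_words ratio \<delta>" for \<delta> u
  proof -
    have "card {m. m \<in> cubes \<delta> \<and> ?R \<delta> u m} \<le> card {m. ?R \<delta> u m}"
      using N(3)[OF that] by (intro card_mono) auto
    then show ?thesis using N(3)[OF that] by linarith
  qed
  have upper: "M \<delta> \<le> N powr q * N * (\<Sum>u\<in>stopping_words ratio \<delta>. ?m u powr q)" if \<delta>: "0 < \<delta>" "\<delta> < 1" for \<delta>
    unfolding M_def
  proof (rule sum_powr_le_of_bounded_multiplicity[where R = "?R \<delta>"])
    fix m assume "m \<in> cubes \<delta>"
    let ?A = "{u \<in> stopping_words ratio \<delta>. ?R \<delta> u m}"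
    have "?\<pi> -` mesh_cube \<delta> m \<subseteq> (\<Union>u\<in>?A. cylinder u)"
    proof
      fix v assume v: "v \<in> ?\<pi> -` mesh_cube \<delta> m"
      obtain n where n: "prefix_of v n \<in> stopping_words ratio \<delta>"
        using ex_prefix_in_stopping_ratio[OF \<delta>(1)] by blast
      then have "prefix_of v n \<in> ?A" using v coding_map_in[of v n] by auto
      moreover have "v \<in> cylinder (prefix_of v n)" by (simp add: cylinder_eqI)
      ultimately show "v \<in> (\<Union>u\<in>?A. cylinder u)" by blast
    qed
    then have "prob (?\<pi> -` mesh_cube \<delta> m) \<le> prob (\<Union>u\<in>?A. cylinder u)"
      using cyl finite_stopping_ratio[OF \<delta>(1)] by (intro finite_measure_mono) auto
    also have "\<dots> \<le> (\<Sum>u\<in>?A. ?m u)"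
      using cyl finite_stopping_ratio[OF \<delta>(1)] by (intro finite_measure_subadditive_finite) auto
    finally show "measure ?\<nu> (mesh_cube \<delta> m) \<le> (\<Sum>u | u \<in> stopping_words ratio \<delta> \<and> ?R \<delta> u m. ?m u)"
      by (simp add: \<nu>)
  qed (use \<delta> N(2) cardB fin_cubes finite_stopping_ratio q in auto)
  have lower: "(\<Sum>u\<in>stopping_words ratio \<delta>. ?m u powr q) \<le> N powr q * N * M \<delta>" if \<delta>: "0 < \<delta>" "\<delta> < 1" for \<delta>
    unfolding M_def
  proof (rule sum_powr_le_of_bounded_multiplicity[where R = "\<lambda>m u. ?R \<delta> u m"])
    fix u assume u: "u \<in> stopping_words ratio \<delta>"
    let ?B = "{m \<in> cubes \<delta>. ?R \<delta> u m}"
    have "cylinder u \<subseteq> (\<Union>m\<in>?B. ?\<pi> -` mesh_cube \<delta> m)"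
    proof
      fix v assume "v \<in> cylinder u"
      then have v: "?\<pi> v \<in> Jw u" by (rule cyl_Jw)
      let ?m = "\<chi> j. \<lfloor>?\<pi> v $ j / \<delta>\<rfloor>"
      have "?\<pi> v \<in> mesh_cube \<delta> ?m" by (rule mesh_cube_floor[OF \<delta>(1)])
      then have "?m \<in> ?B" "v \<in> ?\<pi> -` mesh_cube \<delta> ?m" using v Jw_subset by (auto simp: cubes_def)
      then show "v \<in> (\<Union>m\<in>?B. ?\<pi> -` mesh_cube \<delta> m)" by blast
    qed
    then have "?m u \<le> prob (\<Union>m\<in>?B. ?\<pi> -` mesh_cube \<delta> m)"
      using cube fin_cubes[OF \<delta>(1)] by (intro finite_measure_mono) auto
    also have "\<dots> \<le> (\<Sum>m\<in>?B. prob (?\<pi> -` mesh_cube \<delta> m))"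
      using cube fin_cubes[OF \<delta>(1)] by (intro finite_measure_subadditive_finite) auto
    finally show "?m u \<le> (\<Sum>m | m \<in> cubes \<delta> \<and> ?R \<delta> u m. measure ?\<nu> (mesh_cube \<delta> m))"
      by (simp add: \<nu>)
  qed (use \<delta> N(2) cardB fin_cubes finite_stopping_ratio q in auto)
  show ?thesis
    by (rule that[of "N powr q * N" M]) (use N(1) mesh upper lower in auto)
qed

end

section \<open>The critical exponent as the generalized dimension\<close>

lemma powr_comparable:
  fixes x \<delta> b s :: real
  assumes "0 < b" "b \<le> 1" "0 < \<delta>" "b * \<delta> \<le> x" "x \<le> \<delta>"
  shows "x powr s \<le> b powr - \<bar>s\<bar> * \<delta> powr s" "\<delta> powr s \<le> b powr - \<bar>s\<bar> * x powr s"
proof -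
  have "x > 0" using assms by (meson less_le_trans mult_pos_pos)
  \<comment> \<open>Logarithms treat both signs of s at once. The lower side is b * \<delta> \<le>
    x; the upper side uses x \<le> \<delta> and ln b \<le> 0.\<close>
  have "\<bar>ln x - ln \<delta>\<bar> \<le> - ln b"
  proof -
    have "ln (b * \<delta>) \<le> ln x" "ln x \<le> ln \<delta>" using assms \<open>x > 0\<close> by (simp_all add: ln_mono)
    then show ?thesis using assms by (simp add: ln_mult)
  qed
  then have "\<bar>s\<bar> * \<bar>ln x - ln \<delta>\<bar> \<le> \<bar>s\<bar> * (- ln b)" by (rule mult_left_mono) simp
  then have "\<bar>s * ln x - s * ln \<delta>\<bar> \<le> - (\<bar>s\<bar> * ln b)"
    by (simp add: abs_mult[symmetric] right_diff_distrib)
  then show "x powr s \<le> b powr - \<bar>s\<bar> * \<delta> powr s" "\<delta> powr s \<le> b powr - \<bar>s\<bar> * x powr s"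
    using assms \<open>x > 0\<close> by (simp_all add: powr_def flip: exp_add)
qed

lemma pressure_eq_growth_rate:
  fixes \<phi> :: "'i::finite \<Rightarrow> real ^ 'd \<Rightarrow> real ^ 'd"
  assumes "quasi_multiplicative B
      (\<lambda>u. sup_deriv_norm J \<phi> u powr (t * (1 - q)) * measure \<mu> (cylinder u) powr q)"
  shows "pressure J \<phi> \<mu> t q = sgn (1 - q) *
      growth_rate (\<lambda>u. sup_deriv_norm J \<phi> u powr (t * (1 - q)) * measure \<mu> (cylinder u) powr q)"
  unfolding pressure_def
  using tendsto_mult_left[OF growth_rate_tendsto[OF assms], of "sgn (1 - q)"]
  by (intro limI) (simp add: level_sum_def sup_deriv_norm_def)

theorem theorem1p4:
  fixes J V :: "(real ^ 'd) set"
    and \<phi> :: "'i::finite \<Rightarrow> real ^ 'd \<Rightarrow> real ^ 'd"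
    and Jw :: "'i list \<Rightarrow> (real ^ 'd) set"
    and \<mu> :: "(nat \<Rightarrow> 'i) measure"
    and q :: real
  assumes "CARD('i) \<ge> 2"
    and "acifs J \<phi> V Jw"
    and "open_set_condition Jw"
    and "gibbs_measure \<mu>"
    and "bounded_overlap Jw \<mu>"
    and "q > 0" and "q \<noteq> 1"
  shows "has_gen_dim (image_measure Jw \<mu>) q (ereal (d_crit J \<phi> \<mu> q))"
proof -
  interpret acifs J \<phi> V Jw by (rule assms(2))
  have \<mu>: "prob_space \<mu>" "sets \<mu> = sets word_borel"
    using assms(4) by (auto simp: gibbs_measure_def)
  let ?m = "\<lambda>u. measure \<mu> (cylinder u)"
  obtain B where ratio: "quasi_multiplicative B ratio" using quasi_multiplicative_ratio by blast
  obtain B' where "quasi_multiplicative B' ?m" using gibbs_measure_quasi_multiplicative[OF assms(4)] by blast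
  then have m: "quasi_multiplicative (\<bar>q\<bar> * B') (\<lambda>u. ?m u powr q)" by (rule quasi_multiplicative_powr)
  let ?g = "\<lambda>s u. ratio u powr s * ?m u powr q"
  have g: "quasi_multiplicative (\<bar>s\<bar> * B + \<bar>q\<bar> * B') (?g s)" for s
    by (intro quasi_multiplicative_times quasi_multiplicative_powr ratio m)
  obtain c D where decay: "0 < c" "c < 1" "\<And>u. ratio u \<le> D * c ^ length u"
    using ratio_exponential_decay by metis
  obtain s where s: "growth_rate (?g s) = 0"
    "\<And>t. growth_rate (?g t) < 0 \<longleftrightarrow> s < t" "\<And>t. growth_rate (?g t) > 0 \<longleftrightarrow> t < s"
    by (rule critical_exponent[OF ratio m decay]) (rule that; blast)

  \<comment> \<open>For q > 1 the factor sgn (1 - q) = -1 and the division by 1 - q < 0 each reverse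
    the inequality, so the threshold in t has the same form in both cases.\<close>
  have "pressure J \<phi> \<mu> t q < 0 \<longleftrightarrow> s / (1 - q) < t" for t
  proof (cases "q < 1")
    case True
    then have "pressure J \<phi> \<mu> t q < 0 \<longleftrightarrow> s < t * (1 - q)"
      unfolding pressure_eq_growth_rate[OF g] s(2)[symmetric] by simp
    then show ?thesis using True by (simp add: pos_divide_less_eq)
  next
    case False
    then have "1 - q < 0" using assms(7) by simp
    then have "pressure J \<phi> \<mu> t q < 0 \<longleftrightarrow> t * (1 - q) < s"
      unfolding pressure_eq_growth_rate[OF g] s(3)[symmetric] by simp
    then show ?thesis using \<open>1 - q < 0\<close> by (simp add: neg_divide_less_eq)
  qed
  then have "{t. pressure J \<phi> \<mu> t q < 0} = {s / (1 - q) <..}" by auto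
  then have d: "d_crit J \<phi> \<mu> q = s / (1 - q)" by (simp add: d_crit_def)

  obtain b where b: "0 < b" "b \<le> 1" "\<And>\<delta> u. \<delta> < ratio [] \<Longrightarrow> u \<in> stopping_words ratio \<delta> \<Longrightarrow> b * \<delta> \<le> ratio u"
    using quasi_multiplicative_stopping_lower[OF ratio] by metis
  obtain M K where K: "K > 0"
    and M: "\<And>\<delta>. 0 < \<delta> \<Longrightarrow> \<delta> < 1 \<Longrightarrow> mesh_sum (image_measure Jw \<mu>) q \<delta> = ennreal (M \<delta>)"
    and upper: "\<And>\<delta>. 0 < \<delta> \<Longrightarrow> \<delta> < 1 \<Longrightarrow> M \<delta> \<le> K * (\<Sum>u\<in>stopping_words ratio \<delta>. ?m u powr q)"
    and lower: "\<And>\<delta>. 0 < \<delta> \<Longrightarrow> \<delta> < 1 \<Longrightarrow> (\<Sum>u\<in>stopping_words ratio \<delta>. ?m u powr q) \<le> K * M \<delta>"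
    by (rule mesh_sum_comparable[OF assms(3) \<mu> assms(6)]) (rule that; blast)
  \<comment> \<open>The first factor pays for replacing ratio u by \<delta> on the cut, the second
    is the bound on critical cut sums.\<close>
  define E where "E = b powr - \<bar>s\<bar> * exp (3 * (\<bar>s\<bar> * B + \<bar>q\<bar> * B'))"
  have "E > 0" using b by (simp add: E_def)
  have cut: "(\<Sum>u\<in>stopping_words ratio \<delta>. ?m u powr q) \<le> E * \<delta> powr - s"
    "\<delta> powr - s \<le> E * (\<Sum>u\<in>stopping_words ratio \<delta>. ?m u powr q)" if \<delta>: "0 < \<delta>" "\<delta> < 1" for \<delta>
  proof -
    let ?A = "stopping_words ratio \<delta>" and ?B = "\<bar>s\<bar> * B + \<bar>q\<bar> * B'"
    obtain n where n: "is_cut n ?A" using is_cut_stopping_ratio[OF \<delta>(1)] ..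
    have sum: "exp (- (3 * ?B)) \<le> sum (?g s) ?A" "sum (?g s) ?A \<le> exp (3 * ?B)"
      using cut_sum_bounds[OF g s(1) n] by simp_all
    have cmp: "ratio u powr s \<le> b powr - \<bar>s\<bar> * \<delta> powr s" "\<delta> powr s \<le> b powr - \<bar>s\<bar> * ratio u powr s"
      if "u \<in> ?A" for u
      using powr_comparable[OF b(1,2) \<delta>(1), of "ratio u" s] b(3)[OF _ that] \<delta> that
      by (simp_all add: ratio_Nil stopping_words_def)
    \<comment> \<open>The factor \<delta> powr s turns the plain powers of the masses into the
      critical weights \<open>?g s\<close>, whose sum over the cut is bounded.\<close>
    have "\<delta> powr s * (\<Sum>u\<in>?A. ?m u powr q) \<le> b powr - \<bar>s\<bar> * sum (?g s) ?A"
      unfolding sum_distrib_left mult.assoc[symmetric]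
      using cmp(2) by (intro sum_mono mult_right_mono) auto
    also have "\<dots> \<le> E" unfolding E_def using sum(2) by (intro mult_left_mono) auto
    finally show "(\<Sum>u\<in>?A. ?m u powr q) \<le> E * \<delta> powr - s"
      using \<delta> by (simp add: powr_minus field_simps)
    have "exp (- (3 * ?B)) \<le> sum (?g s) ?A" by (rule sum(1))
    also have "\<dots> \<le> b powr - \<bar>s\<bar> * \<delta> powr s * (\<Sum>u\<in>?A. ?m u powr q)"
      unfolding sum_distrib_left using cmp(1) by (intro sum_mono mult_right_mono) auto
    finally have "exp (3 * ?B) * exp (- (3 * ?B)) \<le>
        exp (3 * ?B) * (b powr - \<bar>s\<bar> * \<delta> powr s * (\<Sum>u\<in>?A. ?m u powr q))"
      by (rule mult_left_mono) simp
    moreover have "exp (3 * ?B) * exp (- (3 * ?B)) = 1" by (simp flip: exp_add)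
    ultimately have "1 \<le> E * (\<delta> powr s * (\<Sum>u\<in>?A. ?m u powr q))"
      unfolding E_def by (simp only: mult_ac)
    then show "\<delta> powr - s \<le> E * (\<Sum>u\<in>?A. ?m u powr q)"
      using \<delta> by (simp add: powr_minus field_simps)
  qed
  show ?thesis
    unfolding d
  proof (rule has_gen_dimI[where K = "E * K", OF assms(7) _ M])
    fix \<delta> :: real assume \<delta>: "0 < \<delta>" "\<delta> < 1"
    have "\<delta> powr - s \<le> E * (\<Sum>u\<in>stopping_words ratio \<delta>. ?m u powr q)" by (rule cut(2)[OF \<delta>])
    also have "\<dots> \<le> E * (K * M \<delta>)" using lower[OF \<delta>] \<open>E > 0\<close> by (intro mult_left_mono) auto
    finally show "\<delta> powr - s \<le> E * K * M \<delta>" by (simp add: mult.assoc)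
    have "M \<delta> \<le> K * (\<Sum>u\<in>stopping_words ratio \<delta>. ?m u powr q)" by (rule upper[OF \<delta>])
    also have "\<dots> \<le> K * (E * \<delta> powr - s)" using cut(1)[OF \<delta>] K by (intro mult_left_mono) auto
    finally show "M \<delta> \<le> E * K * \<delta> powr - s" by (simp add: mult_ac)
  qed (use K \<open>E > 0\<close> in auto)
qed

end
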